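(* Let $m,g,L,j_\perp,j_\parallel>0$, $\mathbf J=\mathrm{diag}(j_\perp,j_\perp,j_\parallel)$, and let $\mathbf b\in\mathbb R^3$ be an unknown constant disturbance. Consider the rigid body with state $(\mathbf p,\mathbf v,\mathbf R,\boldsymbol\omega)\in\mathbb R^3\times\mathbb R^3\times \mathrm{SO}(3)\times\mathbb R^3$ and input $\mathbf u\in\mathbb R^3$ (idealized instantaneous thrust-vector actuation) $$\dot{\mathbf p}=\mathbf v,\qquad \dot{\mathbf R}=\mathbf R\,\mathbf S(\boldsymbol\omega),\qquad \dot{\mathbf v}=g\mathbf e_3+\tfrac1m\mathbf R\mathbf u+\mathbf b,\qquad \dot{\boldsymbol\omega}=-\mathbf J^{-1}\mathbf S(\boldsymbol\omega)\mathbf J\boldsymbol\omega+L\,\mathbf J^{-1}\mathbf S(\mathbf e_3)\mathbf u .$$ Assume that $\delta=\dfrac{j_\perp}{mL}$ and that the gyroscopic term $\boldsymbol\Gamma_0$ (defined in the context) vanishes identically along the motion (which is the case when $\omega_3=0$). Let $\mathbf p_d:[0,\infty)\to\mathbb R^3$ be a reference trajectory of class at least $\mathcal C^4$ with bounded time derivatives. Apply the control law $$\mathbf u=-\tfrac1L\,\mathbf S(\mathbf e_3)\mathbf R^{\mathsf T}\boldsymbol\Gamma_c-m\left(\boldsymbol\xi^{\mathsf T}\mathbf r_3+\delta\|\boldsymbol\Omega_{12}\|^2\right)\mathbf e_3$$ together with the adaptation laws $$\dot{\widehat{\mathbf b}}_1=\boldsymbol\Lambda_1\mathbf e,\qquad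 \dot{\widehat{\mathbf b}}_2=-h_r\boldsymbol\Lambda_2\boldsymbol\Xi^{\mathsf T}\mathbf z_{\mathbf r},\qquad \dot{\widehat{\mathbf b}}_3=-h_\Omega\boldsymbol\Lambda_3\boldsymbol\Theta^{\mathsf T}\mathbf z_{\boldsymbol\Omega},$$ where all the quantities are those defined in the context (and $\boldsymbol\xi\ne\mathbf 0$ along the motion, so that these are well defined). Then: (i) the tracking errors $(\mathbf z_1,\mathbf z_2,\mathbf z_{\mathbf r},\mathbf z_{\boldsymbol\Omega})$ are almost globally asymptotically convergent to zero, i.e. $(\mathbf z_1,\mathbf z_2,\mathbf z_{\mathbf r},\mathbf z_{\boldsymbol\Omega})(t)\to\mathbf 0$ as $t\to\infty$ for all initial conditions outside the measure-zero set where $\mathbf r_3=-\mathbf r_{3d}$; (ii) all closed-loop signals (the errors $\mathbf z_1,\mathbf z_2,\mathbf e,\mathbf z_{\mathbf r},\mathbf z_{\boldsymbol\Omega}$, the estimates $\widehat{\mathbf b}_1,\widehat{\mathbf b}_2,\widehat{\mathbf b}_3$, and $\mathbf v_\delta,\boldsymbol\xi,\overline{u_3},\boldsymbol\Omega_{12},\boldsymbol\Omega_{12c},\boldsymbol\Gamma_c,\mathbf u$) remain bounded; (iii) $\widehat{\mathbf b}_1(t)\to\mathbf b$ as $t\to\infty$.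
   Context: Notation. $\mathbf S(\mathbf x)$ is the $3\times3$ skew-symmetric matrix with $\mathbf S(\mathbf x)\mathbf y=\mathbf x\times\mathbf y$, and $\mathbf S^2(\mathbf x)=\mathbf S(\mathbf x)\mathbf S(\mathbf x)$; $\mathbf e_1,\mathbf e_2,\mathbf e_3$ is the canonical basis of $\mathbb R^3$ (not to be confused with the error $\mathbf e$ below); $\mathbf I$ is the identity; $\|\cdot\|$ is the Euclidean norm. "Positive definite" matrices are symmetric. Reduced attitude. $\mathbf r_i=\mathbf R\mathbf e_i$, $\boldsymbol\Omega=\mathbf R\boldsymbol\omega$, $\boldsymbol\Omega_{12}=-\mathbf S^2(\mathbf r_3)\boldsymbol\Omega=\omega_1\mathbf r_1+\omega_2\mathbf r_2$, so that $\dot{\mathbf r}_3=-\mathbf S(\mathbf r_3)\boldsymbol\Omega_{12}$. The gyroscopic term is $$\boldsymbol\Gamma_0=j_\perp\mathbf S^2(\mathbf r_3)\left(\mathbf R\mathbf J^{-1}\mathbf S(\boldsymbol\omega)\mathbf J\boldsymbol\omega-\mathbf S(\boldsymbol\Omega)\boldsymbol\Omega_{12}\right).$$ The control point is $\mathbf p_\delta=\mathbf p-\delta\mathbf r_3$, with velocity $\mathbf v_\delta=\mathbf v+\delta\,\mathbf S(\mathbf r_3)\boldsymbol\Omega_{12}$. When $\delta=j_\perp/(mL)$ and $\boldsymbol\Gamma_0=\mathbf 0$, with $\overline{u_3}=u_3/m+\delta\|\boldsymbol\Omega_{12}\|^2$ ($u_3$ the third component of $\mathbf u$), one has $\dot{\mathbf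 p}_\delta=\mathbf v_\delta$, $\dot{\mathbf v}_\delta=g\mathbf e_3+\overline{u_3}\mathbf r_3+\mathbf b$, $\dot{\boldsymbol\Omega}_{12}=\frac{1}{j_\perp}L\,\mathbf S(\mathbf r_3)\mathbf R\mathbf u$. Gains. $\mathbf K_p,\mathbf K_v,\boldsymbol\Lambda_1,\boldsymbol\Lambda_2,\boldsymbol\Lambda_3\in\mathbb R^{3\times3}$ positive definite constant matrices; $h_r,k_r,h_\Omega,k_\Omega>0$ constants. $\widehat{\mathbf b}_1,\widehat{\mathbf b}_2,\widehat{\mathbf b}_3\in\mathbb R^3$ are three estimates of $\mathbf b$ (controller states). Write $\mathbf M=\mathbf K_p+\mathbf K_v$ and $\mathbf N=\mathbf I+\mathbf K_v\mathbf K_p$. Errors and controller quantities. - $\mathbf z_1=\mathbf p_\delta-\mathbf p_d$, $\mathbf z_2=\mathbf v_\delta-\dot{\mathbf p}_d$, $\mathbf e=\mathbf z_2+\mathbf K_p\mathbf z_1$. - $\boldsymbol\zeta=\mathbf N\mathbf z_1+\mathbf M\mathbf z_2$, $\boldsymbol\xi=\boldsymbol\zeta+g\mathbf e_3+\widehat{\mathbf b}_1-\ddot{\mathbf p}_d$, $\mathbf r_{3d}=\boldsymbol\xi/\|\boldsymbol\xi\|$ (for $\boldsymbol\xi\neq\mathbf 0$), $\overline{u_3}=-\boldsymbol\xi^{\mathsf T}\mathbf r_3$ (this is the value of $\overline{u_3}$ imposed by the control law). - $\mathbf z_{\mathbf r}=\mathbf S(\mathbf r_{3d})\mathbf r_3$.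 - (Hatted quantities; $\dot{\widehat{\mathbf b}}_1$ stands for $\boldsymbol\Lambda_1\mathbf e$.) $\widehat{\dot{\mathbf z}}_2=g\mathbf e_3+\overline{u_3}\mathbf r_3+\widehat{\mathbf b}_2-\ddot{\mathbf p}_d$; $\widehat{\dot{\boldsymbol\zeta}}=\mathbf N\mathbf z_2+\mathbf M\widehat{\dot{\mathbf z}}_2$; $\widehat{\dot{\boldsymbol\xi}}=\widehat{\dot{\boldsymbol\zeta}}+\dot{\widehat{\mathbf b}}_1-\dddot{\mathbf p}_d$; $\widehat{\dot{\mathbf r}}_{3d}=-\|\boldsymbol\xi\|^{-1}\mathbf S^2(\mathbf r_{3d})\widehat{\dot{\boldsymbol\xi}}$; $\widehat{\boldsymbol\Omega}_{12d}=\mathbf S(\mathbf r_{3d})\widehat{\dot{\mathbf r}}_{3d}$. - $\boldsymbol\Omega_{12c}=-\frac{k_r}{h_r}\mathbf z_{\mathbf r}+\frac1{h_r}\|\boldsymbol\xi\|\mathbf S(\mathbf r_3)\mathbf e-\mathbf S^2(\mathbf r_3)\widehat{\boldsymbol\Omega}_{12d}$, $\mathbf z_{\boldsymbol\Omega}=\boldsymbol\Omega_{12}-\boldsymbol\Omega_{12c}$. - $\boldsymbol\Xi=-\|\boldsymbol\xi\|^{-1}\mathbf S^2(\mathbf r_3)\mathbf S(\mathbf r_{3d})\mathbf M$. - $\boldsymbol\Gamma_c=-j_\perp\left(\frac{k_\Omega}{h_\Omega}\mathbf z_{\boldsymbol\Omega}+\frac{h_r}{h_\Omega}\mathbf z_{\mathbf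 r}+\mathbf S^2(\mathbf r_3)\overline{\dot{\boldsymbol\Omega}}_{12c}\right)$. Here $\overline{\dot{\boldsymbol\Omega}}_{12c}$ is the expression for $\dot{\boldsymbol\Omega}_{12c}$ with the unknown $\mathbf b$ replaced by $\widehat{\mathbf b}_3$, and $\boldsymbol\Theta$ is the matrix with $\overline{\dot{\boldsymbol\Omega}}_{12c}=\dot{\boldsymbol\Omega}_{12c}+\boldsymbol\Theta(\widehat{\mathbf b}_3-\mathbf b)$. Explicitly (with $\dot{\mathbf r}_3=-\mathbf S(\mathbf r_3)\boldsymbol\Omega_{12}$, and $\dot{\widehat{\mathbf b}}_2$ given by its adaptation law; overbars denote "known parts"): $$\overline{\dot{\boldsymbol\Omega}}_{12c}=\tfrac1{h_r}\left[\mathbf S(\mathbf r_3)\mathbf e\,\mathbf r_{3d}^{\mathsf T}\overline{\dot{\boldsymbol\xi}}+\|\boldsymbol\xi\|\left(\mathbf S(\dot{\mathbf r}_3)\mathbf e+\mathbf S(\mathbf r_3)\overline{\dot{\mathbf e}}\right)\right]-\tfrac{k_r}{h_r}\overline{\dot{\mathbf z}}_{\mathbf r}-\left(\mathbf S(\dot{\mathbf r}_3)\mathbf S(\mathbf r_3)+\mathbf S(\mathbf r_3)\mathbf S(\dot{\mathbf r}_3)\right)\widehat{\boldsymbol\Omega}_{12d}-\mathbf S^2(\mathbf r_3)\overline{\dot{\boldsymbol\Omega}}_{12d},$$ where $\overline{\dot{\mathbf z}}_2=\widehat{\dot{\mathbf z}}_2-\widehat{\mathbf b}_2+\widehat{\mathbf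 b}_3$; $\overline{\dot{\mathbf e}}=\mathbf K_p\mathbf z_2+\overline{\dot{\mathbf z}}_2$; $\overline{\dot{\boldsymbol\zeta}}=\mathbf N\mathbf z_2+\mathbf M\overline{\dot{\mathbf z}}_2$; $\overline{\dot{\boldsymbol\xi}}=\overline{\dot{\boldsymbol\zeta}}+\dot{\widehat{\mathbf b}}_1-\dddot{\mathbf p}_d$; $\overline{\dot{\mathbf r}}_{3d}=-\|\boldsymbol\xi\|^{-1}\mathbf S^2(\mathbf r_{3d})\overline{\dot{\boldsymbol\xi}}$; $\overline{\dot{\mathbf z}}_{\mathbf r}=\mathbf S(\mathbf r_{3d})\dot{\mathbf r}_3-\mathbf S(\mathbf r_3)\overline{\dot{\mathbf r}}_{3d}$; $\overline{\dot{\boldsymbol\Omega}}_{12d}=-\mathbf S(\widehat{\dot{\mathbf r}}_{3d})\overline{\dot{\mathbf r}}_{3d}+\mathbf S(\mathbf r_{3d})\overline{\ddot{\mathbf r}}_{3d}$; $$\overline{\ddot{\mathbf r}}_{3d}=-\|\boldsymbol\xi\|^{-1}\mathbf S^2(\mathbf r_{3d})\overline{\ddot{\boldsymbol\xi}}+\frac{\mathbf r_{3d}^{\mathsf T}\overline{\dot{\boldsymbol\xi}}}{\|\boldsymbol\xi\|^2}\mathbf S^2(\mathbf r_{3d})\widehat{\dot{\boldsymbol\xi}}-\|\boldsymbol\xi\|^{-1}\left(\mathbf S(\overline{\dot{\mathbf r}}_{3d})\mathbf S(\mathbf r_{3d})+\mathbf S(\mathbf r_{3d})\mathbf S(\overline{\dot{\mathbf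 r}}_{3d})\right)\widehat{\dot{\boldsymbol\xi}};$$ $\overline{\ddot{\boldsymbol\xi}}=\overline{\ddot{\boldsymbol\zeta}}+\boldsymbol\Lambda_1\overline{\dot{\mathbf e}}-\ddddot{\mathbf p}_d$; $\overline{\ddot{\boldsymbol\zeta}}=\mathbf N\overline{\dot{\mathbf z}}_2+\mathbf M\overline{\ddot{\mathbf z}}_2$; $\overline{\ddot{\mathbf z}}_2=\overline{u_3}\dot{\mathbf r}_3+\overline{\dot{\overline{u_3}}}\,\mathbf r_3+\dot{\widehat{\mathbf b}}_2-\dddot{\mathbf p}_d$; $\overline{\dot{\overline{u_3}}}=-\mathbf r_3^{\mathsf T}\overline{\dot{\boldsymbol\xi}}-\boldsymbol\xi^{\mathsf T}\dot{\mathbf r}_3$. And $$\boldsymbol\Theta_1=-\boldsymbol\Lambda_1-\mathbf I-\mathbf K_v\mathbf K_p+\mathbf M\mathbf r_3\mathbf r_3^{\mathsf T}\mathbf M,\qquad \boldsymbol\Theta_2=\|\boldsymbol\xi\|^{-1}\mathbf S^2(\mathbf r_{3d})\mathbf M,$$ $$\boldsymbol\Theta_3=\|\boldsymbol\xi\|^{-1}\left(2\widehat{\dot{\boldsymbol\xi}}\mathbf r_{3d}^{\mathsf T}-\mathbf r_{3d}\widehat{\dot{\boldsymbol\xi}}{}^{\mathsf T}-(\mathbf r_{3d}^{\mathsf T}\widehat{\dot{\boldsymbol\xi}})\mathbf I\right)\boldsymbol\Theta_2-\|\boldsymbol\xi\|^{-1}\mathbf S^2(\mathbf r_{3d})\boldsymbol\Theta_1-\|\boldsymbol\xi\|^{-2}\mathbf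 S^2(\mathbf r_{3d})\widehat{\dot{\boldsymbol\xi}}\mathbf r_{3d}^{\mathsf T}\mathbf M,$$ $$\boldsymbol\Theta_4=\mathbf S(\mathbf r_{3d})\boldsymbol\Theta_3-\mathbf S(\widehat{\dot{\mathbf r}}_{3d})\boldsymbol\Theta_2,$$ $$\boldsymbol\Theta=-\tfrac{k_r}{h_r}\mathbf S(\mathbf r_3)\boldsymbol\Theta_2+\mathbf S^2(\mathbf r_3)\boldsymbol\Theta_4+\tfrac{\|\boldsymbol\xi\|}{h_r}\mathbf S(\mathbf r_3)+\tfrac1{h_r}\mathbf S(\mathbf r_3)\mathbf e\,\mathbf r_{3d}^{\mathsf T}\mathbf M.$$
   Formalization: Convergence of z_r and z_Ω, and boundedness of Ω₁₂, Ω₁₂c, Γ_c and u, are claimed only when ‖ξ‖ is bounded below by a positive constant along the motion; with only ξ ≠ 0 claim (ii) is false, since Ω₁₂ and u can be unbounded when ξ tends to 0. *)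

theory Defs
  imports "HOL-Analysis.Analysis"
begin

section \<open>Vectors, matrices, signals\<close>

definition skew :: "real^3 \<Rightarrow> real^3^3" where
  "skew a = matrix (cross3 a)"

definition skew2 :: "real^3 \<Rightarrow> real^3^3" where
  "skew2 a = skew a ** skew a"

definition outer :: "real^3 \<Rightarrow> real^3 \<Rightarrow> real^3^3" where
  "outer a b = (\<chi> i j. a $ i * b $ j)"

definition pos_def_matrix :: "real^3^3 \<Rightarrow> bool" where
  "pos_def_matrix A \<longleftrightarrow> transpose A = A \<and> (\<forall>x. x \<noteq> 0 \<longrightarrow> 0 < x \<bullet> (A *v x))"

text \<open>Time derivatives on the half-line are one-sided at \<open>0\<close>.\<close>

definition tderiv :: "nat \<Rightarrow> (real \<Rightarrow> 'a::real_normed_vector) \<Rightarrow> real \<Rightarrow> 'a" where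
  "tderiv k f = ((\<lambda>h t. vector_derivative h (at t within {0..})) ^^ k) f"

definition C_class :: "nat \<Rightarrow> (real \<Rightarrow> 'a::real_normed_vector) \<Rightarrow> bool" where
  "C_class k f \<longleftrightarrow>
     (\<forall>i<k. \<forall>t\<ge>0. tderiv i f differentiable (at t within {0..})) \<and>
     continuous_on {0..} (tderiv k f)"

definition bounded_signal :: "(real \<Rightarrow> 'a::metric_space) \<Rightarrow> bool" where
  "bounded_signal f \<longleftrightarrow> bounded (f ` {0..})"

text \<open>The normalised left Haar measure of SO(3), as a Borel measure on the \<open>3 \<times> 3\<close>
  matrices concentrated on SO(3).\<close>

definition haar_SO3 :: "(real^3^3) measure \<Rightarrow> bool" where
  "haar_SO3 \<mu> \<longleftrightarrow> sets \<mu> = sets borel \<and>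
     emeasure \<mu> {R. rotation_matrix R} = 1 \<and> emeasure \<mu> {R. \<not> rotation_matrix R} = 0 \<and>
     (\<forall>Q. rotation_matrix Q \<longrightarrow> distr \<mu> borel (\<lambda>R. Q ** R) = \<mu>)"


section \<open>Parameters and state\<close>

record params =
  mass :: real
  grav :: real
  arm :: real
  jperp :: real
  jpar :: real
  delta :: real
  Kp :: "real^3^3"
  Kv :: "real^3^3"
  Lam1 :: "real^3^3"
  Lam2 :: "real^3^3"
  Lam3 :: "real^3^3"
  hr :: real
  kr :: real
  hOm :: real
  kOm :: real

text \<open>\<open>bh1\<close>, \<open>bh2\<close>, \<open>bh3\<close> are the controller's three estimates of the disturbance.\<close>

record state =
  pos :: "real^3"
  vel :: "real^3"
  att :: "real^3^3"
  angvel :: "real^3"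
  bh1 :: "real^3"
  bh2 :: "real^3"
  bh3 :: "real^3"

definition valid_params :: "params \<Rightarrow> bool" where
  "valid_params P \<longleftrightarrow>
     0 < mass P \<and> 0 < grav P \<and> 0 < arm P \<and> 0 < jperp P \<and> 0 < jpar P \<and>
     pos_def_matrix (Kp P) \<and> pos_def_matrix (Kv P) \<and>
     pos_def_matrix (Lam1 P) \<and> pos_def_matrix (Lam2 P) \<and> pos_def_matrix (Lam3 P) \<and>
     0 < hr P \<and> 0 < kr P \<and> 0 < hOm P \<and> 0 < kOm P"

definition inertia :: "params \<Rightarrow> real^3^3" where
  "inertia P = (\<chi> i j. if i = j then (if i = 3 then jpar P else jperp P) else 0)"

definition Mmat :: "params \<Rightarrow> real^3^3" where
  "Mmat P = Kp P + Kv P"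

definition Nmat :: "params \<Rightarrow> real^3^3" where
  "Nmat P = mat 1 + Kv P ** Kp P"

abbreviation e3 :: "real^3" where
  "e3 \<equiv> axis 3 1"


section \<open>Reduced attitude and control point\<close>

definition r3 :: "state \<Rightarrow> real^3" where
  "r3 x = att x *v e3"

definition Om :: "state \<Rightarrow> real^3" where
  "Om x = att x *v angvel x"

definition Om12 :: "state \<Rightarrow> real^3" where
  "Om12 x = - (skew2 (r3 x) *v Om x)"

definition dr3 :: "state \<Rightarrow> real^3" where
  "dr3 x = - (skew (r3 x) *v Om12 x)"

definition Gam0 :: "params \<Rightarrow> state \<Rightarrow> real^3" where
  "Gam0 P x = jperp P *\<^sub>R (skew2 (r3 x) *v
     (att x *v (matrix_inv (inertia P) *v (skew (angvel x) *v (inertia P *v angvel x)))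
      - skew (Om x) *v Om12 x))"

definition p_del :: "params \<Rightarrow> state \<Rightarrow> real^3" where
  "p_del P x = pos x - delta P *\<^sub>R r3 x"

definition v_del :: "params \<Rightarrow> state \<Rightarrow> real^3" where
  "v_del P x = vel x + delta P *\<^sub>R (skew (r3 x) *v Om12 x)"


section \<open>Errors and controller quantities\<close>

text \<open>All quantities are functions of the parameters, the reference trajectory \<open>pd\<close>, the time
  and the state; none of them involves the unknown disturbance. The suffix \<open>hat\<close> marks a formal
  time derivative in which the disturbance is replaced by \<open>bh2\<close>, the suffix \<open>bar\<close> one in which it
  is replaced by \<open>bh3\<close>. Division by the norm of \<open>xi\<close> is meaningful only where \<open>xi\<close> is nonzero.\<close>

definition z1 :: "params \<Rightarrow> (real \<Rightarrow> real^3) \<Rightarrow> real \<Rightarrow> state \<Rightarrow> real^3" where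
  "z1 P pd t x = p_del P x - pd t"

definition z2 :: "params \<Rightarrow> (real \<Rightarrow> real^3) \<Rightarrow> real \<Rightarrow> state \<Rightarrow> real^3" where
  "z2 P pd t x = v_del P x - tderiv 1 pd t"

definition err :: "params \<Rightarrow> (real \<Rightarrow> real^3) \<Rightarrow> real \<Rightarrow> state \<Rightarrow> real^3" where
  "err P pd t x = z2 P pd t x + Kp P *v z1 P pd t x"

definition zeta :: "params \<Rightarrow> (real \<Rightarrow> real^3) \<Rightarrow> real \<Rightarrow> state \<Rightarrow> real^3" where
  "zeta P pd t x = Nmat P *v z1 P pd t x + Mmat P *v z2 P pd t x"

definition xi :: "params \<Rightarrow> (real \<Rightarrow> real^3) \<Rightarrow> real \<Rightarrow> state \<Rightarrow> real^3" where
  "xi P pd t x = zeta P pd t x + grav P *\<^sub>R e3 + bh1 x - tderiv 2 pd t"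

definition r3d :: "params \<Rightarrow> (real \<Rightarrow> real^3) \<Rightarrow> real \<Rightarrow> state \<Rightarrow> real^3" where
  "r3d P pd t x = (1 / norm (xi P pd t x)) *\<^sub>R xi P pd t x"

definition u3_bar :: "params \<Rightarrow> (real \<Rightarrow> real^3) \<Rightarrow> real \<Rightarrow> state \<Rightarrow> real" where
  "u3_bar P pd t x = - (xi P pd t x \<bullet> r3 x)"

definition z_r :: "params \<Rightarrow> (real \<Rightarrow> real^3) \<Rightarrow> real \<Rightarrow> state \<Rightarrow> real^3" where
  "z_r P pd t x = skew (r3d P pd t x) *v r3 x"

definition dbh1 :: "params \<Rightarrow> (real \<Rightarrow> real^3) \<Rightarrow> real \<Rightarrow> state \<Rightarrow> real^3" where
  "dbh1 P pd t x = Lam1 P *v err P pd t x"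

definition dz2_hat :: "params \<Rightarrow> (real \<Rightarrow> real^3) \<Rightarrow> real \<Rightarrow> state \<Rightarrow> real^3" where
  "dz2_hat P pd t x = grav P *\<^sub>R e3 + u3_bar P pd t x *\<^sub>R r3 x + bh2 x - tderiv 2 pd t"

definition dzeta_hat :: "params \<Rightarrow> (real \<Rightarrow> real^3) \<Rightarrow> real \<Rightarrow> state \<Rightarrow> real^3" where
  "dzeta_hat P pd t x = Nmat P *v z2 P pd t x + Mmat P *v dz2_hat P pd t x"

definition dxi_hat :: "params \<Rightarrow> (real \<Rightarrow> real^3) \<Rightarrow> real \<Rightarrow> state \<Rightarrow> real^3" where
  "dxi_hat P pd t x = dzeta_hat P pd t x + dbh1 P pd t x - tderiv 3 pd t"

definition dr3d_hat :: "params \<Rightarrow> (real \<Rightarrow> real^3) \<Rightarrow> real \<Rightarrow> state \<Rightarrow> real^3" where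
  "dr3d_hat P pd t x =
     - ((1 / norm (xi P pd t x)) *\<^sub>R (skew2 (r3d P pd t x) *v dxi_hat P pd t x))"

definition Om12d_hat :: "params \<Rightarrow> (real \<Rightarrow> real^3) \<Rightarrow> real \<Rightarrow> state \<Rightarrow> real^3" where
  "Om12d_hat P pd t x = skew (r3d P pd t x) *v dr3d_hat P pd t x"

definition Om12c :: "params \<Rightarrow> (real \<Rightarrow> real^3) \<Rightarrow> real \<Rightarrow> state \<Rightarrow> real^3" where
  "Om12c P pd t x =
     - ((kr P / hr P) *\<^sub>R z_r P pd t x)
     + (1 / hr P) *\<^sub>R (norm (xi P pd t x) *\<^sub>R (skew (r3 x) *v err P pd t x))
     - skew2 (r3 x) *v Om12d_hat P pd t x"

definition z_Om :: "params \<Rightarrow> (real \<Rightarrow> real^3) \<Rightarrow> real \<Rightarrow> state \<Rightarrow> real^3" where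
  "z_Om P pd t x = Om12 x - Om12c P pd t x"

definition Xi :: "params \<Rightarrow> (real \<Rightarrow> real^3) \<Rightarrow> real \<Rightarrow> state \<Rightarrow> real^3^3" where
  "Xi P pd t x =
     - ((1 / norm (xi P pd t x)) *\<^sub>R (skew2 (r3 x) ** skew (r3d P pd t x) ** Mmat P))"

definition dbh2 :: "params \<Rightarrow> (real \<Rightarrow> real^3) \<Rightarrow> real \<Rightarrow> state \<Rightarrow> real^3" where
  "dbh2 P pd t x = - (hr P *\<^sub>R (Lam2 P *v (transpose (Xi P pd t x) *v z_r P pd t x)))"


subsection \<open>The known part of the derivative of \<open>Om12c\<close>\<close>

definition dz2_bar :: "params \<Rightarrow> (real \<Rightarrow> real^3) \<Rightarrow> real \<Rightarrow> state \<Rightarrow> real^3" where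
  "dz2_bar P pd t x = dz2_hat P pd t x - bh2 x + bh3 x"

definition derr_bar :: "params \<Rightarrow> (real \<Rightarrow> real^3) \<Rightarrow> real \<Rightarrow> state \<Rightarrow> real^3" where
  "derr_bar P pd t x = Kp P *v z2 P pd t x + dz2_bar P pd t x"

definition dzeta_bar :: "params \<Rightarrow> (real \<Rightarrow> real^3) \<Rightarrow> real \<Rightarrow> state \<Rightarrow> real^3" where
  "dzeta_bar P pd t x = Nmat P *v z2 P pd t x + Mmat P *v dz2_bar P pd t x"

definition dxi_bar :: "params \<Rightarrow> (real \<Rightarrow> real^3) \<Rightarrow> real \<Rightarrow> state \<Rightarrow> real^3" where
  "dxi_bar P pd t x = dzeta_bar P pd t x + dbh1 P pd t x - tderiv 3 pd t"

definition dr3d_bar :: "params \<Rightarrow> (real \<Rightarrow> real^3) \<Rightarrow> real \<Rightarrow> state \<Rightarrow> real^3" where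
  "dr3d_bar P pd t x =
     - ((1 / norm (xi P pd t x)) *\<^sub>R (skew2 (r3d P pd t x) *v dxi_bar P pd t x))"

definition dz_r_bar :: "params \<Rightarrow> (real \<Rightarrow> real^3) \<Rightarrow> real \<Rightarrow> state \<Rightarrow> real^3" where
  "dz_r_bar P pd t x = skew (r3d P pd t x) *v dr3 x - skew (r3 x) *v dr3d_bar P pd t x"

definition du3_bar_bar :: "params \<Rightarrow> (real \<Rightarrow> real^3) \<Rightarrow> real \<Rightarrow> state \<Rightarrow> real" where
  "du3_bar_bar P pd t x = - (r3 x \<bullet> dxi_bar P pd t x) - xi P pd t x \<bullet> dr3 x"

definition ddz2_bar :: "params \<Rightarrow> (real \<Rightarrow> real^3) \<Rightarrow> real \<Rightarrow> state \<Rightarrow> real^3" where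
  "ddz2_bar P pd t x =
     u3_bar P pd t x *\<^sub>R dr3 x + du3_bar_bar P pd t x *\<^sub>R r3 x + dbh2 P pd t x - tderiv 3 pd t"

definition ddzeta_bar :: "params \<Rightarrow> (real \<Rightarrow> real^3) \<Rightarrow> real \<Rightarrow> state \<Rightarrow> real^3" where
  "ddzeta_bar P pd t x = Nmat P *v dz2_bar P pd t x + Mmat P *v ddz2_bar P pd t x"

definition ddxi_bar :: "params \<Rightarrow> (real \<Rightarrow> real^3) \<Rightarrow> real \<Rightarrow> state \<Rightarrow> real^3" where
  "ddxi_bar P pd t x = ddzeta_bar P pd t x + Lam1 P *v derr_bar P pd t x - tderiv 4 pd t"

definition ddr3d_bar :: "params \<Rightarrow> (real \<Rightarrow> real^3) \<Rightarrow> real \<Rightarrow> state \<Rightarrow> real^3" where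
  "ddr3d_bar P pd t x =
     - ((1 / norm (xi P pd t x)) *\<^sub>R (skew2 (r3d P pd t x) *v ddxi_bar P pd t x))
     + ((r3d P pd t x \<bullet> dxi_bar P pd t x) / (norm (xi P pd t x))\<^sup>2) *\<^sub>R
         (skew2 (r3d P pd t x) *v dxi_hat P pd t x)
     - (1 / norm (xi P pd t x)) *\<^sub>R
         ((skew (dr3d_bar P pd t x) ** skew (r3d P pd t x)
           + skew (r3d P pd t x) ** skew (dr3d_bar P pd t x)) *v dxi_hat P pd t x)"

definition dOm12d_bar :: "params \<Rightarrow> (real \<Rightarrow> real^3) \<Rightarrow> real \<Rightarrow> state \<Rightarrow> real^3" where
  "dOm12d_bar P pd t x =
     - (skew (dr3d_hat P pd t x) *v dr3d_bar P pd t x) + skew (r3d P pd t x) *v ddr3d_bar P pd t x"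

definition dOm12c_bar :: "params \<Rightarrow> (real \<Rightarrow> real^3) \<Rightarrow> real \<Rightarrow> state \<Rightarrow> real^3" where
  "dOm12c_bar P pd t x =
     (1 / hr P) *\<^sub>R
       ((r3d P pd t x \<bullet> dxi_bar P pd t x) *\<^sub>R (skew (r3 x) *v err P pd t x)
        + norm (xi P pd t x) *\<^sub>R
            (skew (dr3 x) *v err P pd t x + skew (r3 x) *v derr_bar P pd t x))
     - (kr P / hr P) *\<^sub>R dz_r_bar P pd t x
     - (skew (dr3 x) ** skew (r3 x) + skew (r3 x) ** skew (dr3 x)) *v Om12d_hat P pd t x
     - skew2 (r3 x) *v dOm12d_bar P pd t x"

definition Gam_c :: "params \<Rightarrow> (real \<Rightarrow> real^3) \<Rightarrow> real \<Rightarrow> state \<Rightarrow> real^3" where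
  "Gam_c P pd t x =
     - (jperp P *\<^sub>R ((kOm P / hOm P) *\<^sub>R z_Om P pd t x + (hr P / hOm P) *\<^sub>R z_r P pd t x
          + skew2 (r3 x) *v dOm12c_bar P pd t x))"


subsection \<open>The regressor of the third adaptation law\<close>

definition Theta1 :: "params \<Rightarrow> (real \<Rightarrow> real^3) \<Rightarrow> real \<Rightarrow> state \<Rightarrow> real^3^3" where
  "Theta1 P pd t x =
     - Lam1 P - mat 1 - Kv P ** Kp P + Mmat P ** outer (r3 x) (r3 x) ** Mmat P"

definition Theta2 :: "params \<Rightarrow> (real \<Rightarrow> real^3) \<Rightarrow> real \<Rightarrow> state \<Rightarrow> real^3^3" where
  "Theta2 P pd t x = (1 / norm (xi P pd t x)) *\<^sub>R (skew2 (r3d P pd t x) ** Mmat P)"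

definition Theta3 :: "params \<Rightarrow> (real \<Rightarrow> real^3) \<Rightarrow> real \<Rightarrow> state \<Rightarrow> real^3^3" where
  "Theta3 P pd t x =
     (1 / norm (xi P pd t x)) *\<^sub>R
       ((2 *\<^sub>R outer (dxi_hat P pd t x) (r3d P pd t x)
         - outer (r3d P pd t x) (dxi_hat P pd t x)
         - (r3d P pd t x \<bullet> dxi_hat P pd t x) *\<^sub>R mat 1) ** Theta2 P pd t x)
     - (1 / norm (xi P pd t x)) *\<^sub>R (skew2 (r3d P pd t x) ** Theta1 P pd t x)
     - (1 / (norm (xi P pd t x))\<^sup>2) *\<^sub>R
         (skew2 (r3d P pd t x) ** outer (dxi_hat P pd t x) (r3d P pd t x) ** Mmat P)"

definition Theta4 :: "params \<Rightarrow> (real \<Rightarrow> real^3) \<Rightarrow> real \<Rightarrow> state \<Rightarrow> real^3^3" where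
  "Theta4 P pd t x =
     skew (r3d P pd t x) ** Theta3 P pd t x - skew (dr3d_hat P pd t x) ** Theta2 P pd t x"

definition Theta :: "params \<Rightarrow> (real \<Rightarrow> real^3) \<Rightarrow> real \<Rightarrow> state \<Rightarrow> real^3^3" where
  "Theta P pd t x =
     - ((kr P / hr P) *\<^sub>R (skew (r3 x) ** Theta2 P pd t x))
     + skew2 (r3 x) ** Theta4 P pd t x
     + (norm (xi P pd t x) / hr P) *\<^sub>R skew (r3 x)
     + (1 / hr P) *\<^sub>R (skew (r3 x) ** outer (err P pd t x) (r3d P pd t x) ** Mmat P)"

definition dbh3 :: "params \<Rightarrow> (real \<Rightarrow> real^3) \<Rightarrow> real \<Rightarrow> state \<Rightarrow> real^3" where
  "dbh3 P pd t x = - (hOm P *\<^sub>R (Lam3 P *v (transpose (Theta P pd t x) *v z_Om P pd t x)))"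


section \<open>Closed loop\<close>

definition rigid_body_motion ::
    "params \<Rightarrow> real^3 \<Rightarrow> (real \<Rightarrow> real^3) \<Rightarrow> (real \<Rightarrow> state) \<Rightarrow> bool" where
  "rigid_body_motion P b u x \<longleftrightarrow>
     (\<forall>t\<ge>0. rotation_matrix (att (x t)) \<and>
       ((\<lambda>s. pos (x s)) has_vector_derivative vel (x t)) (at t within {0..}) \<and>
       ((\<lambda>s. att (x s)) has_vector_derivative (att (x t) ** skew (angvel (x t))))
          (at t within {0..}) \<and>
       ((\<lambda>s. vel (x s)) has_vector_derivative
          (grav P *\<^sub>R e3 + (1 / mass P) *\<^sub>R (att (x t) *v u t) + b)) (at t within {0..}) \<and>
       ((\<lambda>s. angvel (x s)) has_vector_derivative
          (- (matrix_inv (inertia P) *v (skew (angvel (x t)) *v (inertia P *v angvel (x t))))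
           + arm P *\<^sub>R (matrix_inv (inertia P) *v (skew e3 *v u t)))) (at t within {0..}))"

definition control_law :: "params \<Rightarrow> (real \<Rightarrow> real^3) \<Rightarrow> real \<Rightarrow> state \<Rightarrow> real^3" where
  "control_law P pd t x =
     - ((1 / arm P) *\<^sub>R (skew e3 *v (transpose (att x) *v Gam_c P pd t x)))
     - (mass P * (xi P pd t x \<bullet> r3 x + delta P * (norm (Om12 x))\<^sup>2)) *\<^sub>R e3"

definition adaptation_laws :: "params \<Rightarrow> (real \<Rightarrow> real^3) \<Rightarrow> (real \<Rightarrow> state) \<Rightarrow> bool" where
  "adaptation_laws P pd x \<longleftrightarrow>
     (\<forall>t\<ge>0.
       ((\<lambda>s. bh1 (x s)) has_vector_derivative dbh1 P pd t (x t)) (at t within {0..}) \<and>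
       ((\<lambda>s. bh2 (x s)) has_vector_derivative dbh2 P pd t (x t)) (at t within {0..}) \<and>
       ((\<lambda>s. bh3 (x s)) has_vector_derivative dbh3 P pd t (x t)) (at t within {0..}))"

text \<open>Initial states (at time \<open>0\<close>) whose thrust axis is opposite to the desired one. States with
  vanishing \<open>xi\<close> do not belong to this set, since then \<open>r3d\<close> evaluates to \<open>0\<close>.\<close>

definition antipodal_states :: "params \<Rightarrow> (real \<Rightarrow> real^3) \<Rightarrow> state set" where
  "antipodal_states P pd = {x. rotation_matrix (att x) \<and> r3 x = - r3d P pd 0 x}"

text \<open>Nullity is required in every slice of constant body angular velocity. By Fubini this
  implies nullity in the whole state space, and it remains meaningful on the invariant set where the
  third component of \<open>angvel\<close> vanishes, which is itself null in the state space.\<close>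

definition measure_zero_states :: "state set \<Rightarrow> bool" where
  "measure_zero_states A \<longleftrightarrow>
     (\<forall>\<mu> w. haar_SO3 \<mu> \<longrightarrow>
       {(R, p, v, b1, b2, b3).
          \<lparr>pos = p, vel = v, att = R, angvel = w, bh1 = b1, bh2 = b2, bh3 = b3\<rparr> \<in> A}
       \<in> null_sets (\<mu> \<Otimes>\<^sub>M lborel))"

text \<open>Nonvanishing of \<open>xi\<close> at each time does not keep \<open>xi\<close> away from zero on the half-line: the
  reference acceleration may approach free fall as time goes to infinity. The direction \<open>r3d\<close> can
  then turn arbitrarily fast, so quantities containing its derivatives can be unbounded.\<close>

definition xi_uniformly_nonzero ::
    "params \<Rightarrow> (real \<Rightarrow> real^3) \<Rightarrow> (real \<Rightarrow> state) \<Rightarrow> bool" where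
  "xi_uniformly_nonzero P pd x \<longleftrightarrow> (\<exists>c>0. \<forall>t\<ge>0. c \<le> norm (xi P pd t (x t)))"

end

theory Submission
  imports Defs
begin

text \<open>Write \<open>r\<close> and \<open>e\<close> for \<open>r3\<close> and \<open>err\<close>, and \<open>b1\<close>, \<open>b2\<close>, \<open>b3\<close> for the estimation errors of the
  disturbance. The squared norms of \<open>z1\<close>, \<open>e\<close> and \<open>z_Om\<close>, the function \<open>hr (1 - r \<bullet> r3d)\<close> and the
  quadratic forms of \<open>b1\<close>, \<open>b2\<close>, \<open>b3\<close> given by the inverse adaptation gains add up, suitably weighted,
  to a Lyapunov function \<open>V\<close>. The terms containing the disturbance are absorbed by the adaptation
  laws, the cross terms \<open>e \<bullet> (r \<times> (r \<times> xi))\<close> and \<open>hr (z_r \<bullet> z_Om)\<close> cancel, and what remains of the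
  derivative of \<open>V\<close> is minus a positive definite quadratic form in \<open>(z1, e, z_r, z_Om)\<close>. Hence \<open>V\<close>
  bounds all errors, and every quantity with bounded derivative that is dominated by the dissipation
  tends to zero.

  The norm of \<open>xi\<close> may approach zero at infinity. The vector \<open>xi \<times> r\<close> nevertheless has a bounded
  derivative, so it tends to zero. The error dynamics then read \<open>e' = b1 + o(1)\<close> with \<open>b1\<close> slowly
  varying, and \<open>e \<longlonglongrightarrow> 0\<close> gives \<open>b1 \<longlonglongrightarrow> 0\<close>.\<close>

unbundle cross3_syntax

section \<open>Vectors, matrices and their derivatives\<close>

lemma skew_mult_vec: "skew a *v y = a \<times> y"
proof -
  have "linear ((\<times>) a)"
    using bilinear_cross by (simp add: bilinear_def)
  then show ?thesis by (simp add: skew_def)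
qed

lemma skew2_mult_vec: "skew2 a *v y = a \<times> (a \<times> y)"
  by (simp add: skew2_def skew_mult_vec flip: matrix_vector_mul_assoc)

lemma outer_mult_vec: "outer a c *v y = (c \<bullet> y) *\<^sub>R a"
  by (simp add: outer_def matrix_vector_mult_def inner_vec_def vec_eq_iff sum_distrib_left mult_ac)

lemma matrix_vector_mult_uminus_left: "(- A) *v x = - (A *v x)" for A :: "real^'n^'m"
  by (simp add: matrix_vector_mult_def vec_eq_iff sum_negf)

lemma matrix_vector_mult_uminus_right: "A *v (- x) = - (A *v x)" for A :: "real^'n^'m"
  by (simp add: matrix_vector_mult_def vec_eq_iff sum_negf)

lemmas mat_vec_simps = matrix_vector_mult_add_rdistrib matrix_vector_mult_diff_rdistrib
  matrix_vector_mult_uminus_left matrix_vector_right_distrib matrix_vector_mult_diff_distrib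
  matrix_vector_mult_scaleR matrix_vector_mult_uminus_right scaleR_matrix_vector_assoc[symmetric]

lemma bounded_bilinear_cross3: "bounded_bilinear (\<times>)"
  using bilinear_cross by (simp add: bilinear_conv_bounded_bilinear)

lemma bounded_bilinear_mat_vec: "bounded_bilinear ((*v) :: real^'n^'m \<Rightarrow> _)"
proof -
  have "bilinear ((*v) :: real^'n^'m \<Rightarrow> _)"
    by (auto simp: bilinear_def linear_iff matrix_vector_mult_add_rdistrib
        matrix_vector_right_distrib matrix_vector_mult_scaleR scaleR_matrix_vector_assoc)
  then show ?thesis by (simp add: bilinear_conv_bounded_bilinear)
qed

lemmas has_vector_derivative_cross = bounded_bilinear.has_vector_derivative[OF bounded_bilinear_cross3]
lemmas has_vector_derivative_mat_vec = bounded_bilinear.has_vector_derivative[OF bounded_bilinear_mat_vec]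
lemmas has_vector_derivative_inner = bounded_bilinear.has_vector_derivative[OF bounded_bilinear_inner]
lemmas has_vector_derivative_scaleR' = bounded_bilinear.has_vector_derivative[OF bounded_bilinear_scaleR]

lemma has_vector_derivative_norm:
  fixes f :: "real \<Rightarrow> 'a::real_inner"
  assumes "(f has_vector_derivative f') (at t within S)" "f t \<noteq> 0"
  shows "((\<lambda>s. norm (f s)) has_vector_derivative (f t \<bullet> f' / norm (f t))) (at t within S)"
proof -
  have "((\<lambda>s. norm (f s)) has_derivative (\<lambda>h. (sgn (f t)) \<bullet> (h *\<^sub>R f'))) (at t within S)"
    using has_derivative_compose[OF assms(1)[unfolded has_vector_derivative_def]
        has_derivative_norm[OF assms(2)]]
    by (simp add: inner_commute)
  then show ?thesis
    by (simp add: has_vector_derivative_def sgn_div_norm divide_inverse mult_ac)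
qed

lemma has_vector_derivative_inverse_norm:
  fixes f :: "real \<Rightarrow> 'a::real_inner"
  assumes "(f has_vector_derivative f') (at t within S)" "f t \<noteq> 0"
  shows "((\<lambda>s. 1 / norm (f s)) has_vector_derivative (- (f t \<bullet> f') / norm (f t) ^ 3)) (at t within S)"
proof -
  have "((\<lambda>s. norm (f s)) has_field_derivative (f t \<bullet> f' / norm (f t))) (at t within S)"
    using has_vector_derivative_norm[OF assms]
    by (simp add: has_real_derivative_iff_has_vector_derivative)
  from DERIV_inverse_fun[OF this] assms(2) show ?thesis
    by (simp add: has_real_derivative_iff_has_vector_derivative[symmetric] divide_inverse
        power3_eq_cube power2_eq_square mult_ac)
qed

text \<open>The quadratic form attains a positive minimum on the compact unit sphere, and
  homogeneity of degree two carries this bound to all vectors.\<close>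

lemma pos_def_matrix_coercive:
  assumes "pos_def_matrix A"
  obtains c where "c > 0" "\<And>x. c * (norm x)\<^sup>2 \<le> x \<bullet> (A *v x)"
proof -
  let ?S = "sphere (0::real^3) 1" and ?q = "\<lambda>x. x \<bullet> (A *v x)"
  have "?S \<noteq> {}" by simp
  moreover have "continuous_on ?S ?q"
    by (intro continuous_intros linear_continuous_on matrix_vector_mul_bounded_linear)
  ultimately obtain w where w: "w \<in> ?S" "\<And>y. y \<in> ?S \<Longrightarrow> ?q w \<le> ?q y"
    using continuous_attains_inf[of ?S ?q] by auto
  have "?q w > 0"
    using w(1) assms unfolding pos_def_matrix_def by (metis mem_sphere_0 norm_zero zero_neq_one)
  moreover have "?q w * (norm x)\<^sup>2 \<le> ?q x" for x
  proof (cases "x = 0")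
    case False
    then have "?q w \<le> ?q ((1 / norm x) *\<^sub>R x)"
      by (intro w(2)) simp
    also have "\<dots> = ?q x / (norm x)\<^sup>2"
      by (simp add: matrix_vector_mult_scaleR power2_eq_square)
    finally show ?thesis using False by (simp add: field_simps)
  qed simp
  ultimately show ?thesis using that by blast
qed

lemma inner_mat_vec_commute:
  fixes A :: "real^'n^'n"
  assumes "transpose A = A"
  shows "(A *v x) \<bullet> y = x \<bullet> (A *v y)"
  using dot_lmul_matrix[of x A y] assms by (metis transpose_matrix_vector)

text \<open>The adaptation gains enter the Lyapunov function through their inverses. The form of the
  inverse at \<open>y\<close> is the form of \<open>A\<close> at \<open>B *v y\<close>, hence again
  positive.\<close>

lemma pos_def_matrix_inverse:
  assumes "pos_def_matrix A"
  obtains B where "pos_def_matrix B" "\<And>x. B *v (A *v x) = x"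
proof -
  have inj: "A *v x = 0 \<Longrightarrow> x = 0" for x
    using assms by (force simp: pos_def_matrix_def)
  then obtain B where BA: "B ** A = mat 1"
    using matrix_left_invertible_ker by blast
  then have AB: "A ** B = mat 1"
    by (simp add: matrix_left_right_inverse)
  have A: "transpose A = A" using assms by (simp add: pos_def_matrix_def)
  have "transpose B = B"
    by (metis A AB BA matrix_mul_assoc matrix_mul_lid matrix_mul_rid matrix_transpose_mul transpose_mat)
  moreover have "0 < y \<bullet> (B *v y)" if "y \<noteq> 0" for y
  proof -
    have y: "A *v (B *v y) = y" by (simp add: AB matrix_vector_mul_assoc)
    with that have "B *v y \<noteq> 0" by auto
    then have "0 < (B *v y) \<bullet> (A *v (B *v y))" using assms by (simp add: pos_def_matrix_def)
    then show ?thesis by (simp add: y inner_commute)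
  qed
  ultimately have "pos_def_matrix B" by (simp add: pos_def_matrix_def)
  moreover have "B *v (A *v x) = x" for x by (simp add: BA matrix_vector_mul_assoc)
  ultimately show ?thesis using that by blast
qed

section \<open>Bounded signals and a variant of Barbalat's lemma\<close>

lemma bounded_signal_iff: "bounded_signal f \<longleftrightarrow> (\<exists>B. \<forall>t\<ge>0. norm (f t) \<le> B)"
  for f :: "real \<Rightarrow> 'a::real_normed_vector"
  by (auto simp: bounded_signal_def bounded_iff)

lemma bounded_signalE:
  fixes f :: "real \<Rightarrow> 'a::real_normed_vector"
  assumes "bounded_signal f"
  obtains B where "B > 0" "\<And>t. t \<ge> 0 \<Longrightarrow> norm (f t) \<le> B"
proof -
  obtain B where "\<And>t. t \<ge> 0 \<Longrightarrow> norm (f t) \<le> B"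
    using assms by (auto simp: bounded_signal_iff)
  then have "\<And>t. t \<ge> 0 \<Longrightarrow> norm (f t) \<le> \<bar>B\<bar> + 1" by fastforce
  then show ?thesis using that[of "\<bar>B\<bar> + 1"] by force
qed

section \<open>Closure rules for bounded signals\<close>

named_theorems bounded_intros

text \<open>Cross product, matrix action, inner product, scaling and multiplication are all bounded
  bilinear, so one estimate serves every product in the controller.\<close>

lemma bounded_signal_bilinear:
  assumes "bounded_bilinear h" "bounded_signal f" "bounded_signal g"
  shows "bounded_signal (\<lambda>t. h (f t) (g t))"
proof -
  from bounded_bilinear.nonneg_bounded[OF assms(1)]
  obtain K where K: "K \<ge> 0" "\<And>a b. norm (h a b) \<le> norm a * norm b * K" by blast
  obtain B where B: "B > 0" "\<And>t. t \<ge> 0 \<Longrightarrow> norm (f t) \<le> B" using bounded_signalE[OF assms(2)] by metis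
  obtain C where C: "C > 0" "\<And>t. t \<ge> 0 \<Longrightarrow> norm (g t) \<le> C" using bounded_signalE[OF assms(3)] by metis
  have "norm (h (f t) (g t)) \<le> B * C * K" if "t \<ge> 0" for t
    using B C K(1) that by (intro order_trans[OF K(2)] mult_mono) auto
  then show ?thesis by (auto simp: bounded_signal_iff)
qed

lemmas [bounded_intros] =
  bounded_signal_bilinear[OF bounded_bilinear_cross3]
  bounded_signal_bilinear[OF bounded_bilinear_mat_vec]
  bounded_signal_bilinear[OF bounded_bilinear_inner]
  bounded_signal_bilinear[OF bounded_bilinear_scaleR]
  bounded_signal_bilinear[OF bounded_bilinear_mult]

lemma bounded_signal_const [bounded_intros]: "bounded_signal (\<lambda>t. c)"
  for c :: "'a::real_normed_vector"
  by (auto simp: bounded_signal_iff)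

lemma bounded_signal_minus [bounded_intros]:
  "bounded_signal f \<Longrightarrow> bounded_signal (\<lambda>t. - f t)"
  for f :: "real \<Rightarrow> 'a::real_normed_vector"
  by (simp add: bounded_signal_iff)

lemma bounded_signal_add [bounded_intros]:
  "bounded_signal f \<Longrightarrow> bounded_signal g \<Longrightarrow> bounded_signal (\<lambda>t. f t + g t)"
  for f g :: "real \<Rightarrow> 'a::real_normed_vector"
  unfolding bounded_signal_iff by (meson norm_add_rule_thm norm_triangle_mono)

lemma bounded_signal_diff [bounded_intros]:
  "bounded_signal f \<Longrightarrow> bounded_signal g \<Longrightarrow> bounded_signal (\<lambda>t. f t - g t)"
  for f g :: "real \<Rightarrow> 'a::real_normed_vector"
  using bounded_signal_add[of f "\<lambda>t. - g t"] bounded_signal_minus[of g] by simp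

lemma bounded_signal_norm [bounded_intros]:
  "bounded_signal f \<Longrightarrow> bounded_signal (\<lambda>t. norm (f t))"
  for f :: "real \<Rightarrow> 'a::real_normed_vector"
  by (simp add: bounded_signal_iff)

lemma bounded_signal_cong:
  "bounded_signal g \<Longrightarrow> (\<And>t. t \<ge> 0 \<Longrightarrow> f t = g t) \<Longrightarrow> bounded_signal f"
  unfolding bounded_signal_def by (metis atLeast_iff image_cong)

text \<open>The operator norm of the derivative supplies the Lipschitz constant. The set
  \<open>S\<close> is left general because both the half-line and unit intervals are used.\<close>

lemma vector_derivative_lipschitz:
  fixes f :: "real \<Rightarrow> 'a::real_normed_vector"
  assumes "convex S" "\<And>u. u \<in> S \<Longrightarrow> (f has_vector_derivative f' u) (at u within S)"
    and "\<And>u. u \<in> S \<Longrightarrow> norm (f' u) \<le> C" and "s \<in> S" "t \<in> S"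
  shows "norm (f t - f s) \<le> C * \<bar>t - s\<bar>"
proof -
  have "norm (f t - f s) \<le> C * norm (t - s)"
  proof (rule differentiable_bound[where S = S and f' = "\<lambda>t h. h *\<^sub>R f' t"])
    show "(f has_derivative (\<lambda>h. h *\<^sub>R f' u)) (at u within S)" if "u \<in> S" for u
      using assms(2)[OF that] by (simp add: has_vector_derivative_def)
    show "onorm (\<lambda>h. h *\<^sub>R f' u) \<le> C" if "u \<in> S" for u
      using assms(3)[OF that]
      by (intro onorm_le) (auto simp: mult.commute[of C] intro!: mult_left_mono)
  qed (use assms in auto)
  then show ?thesis by simp
qed

text \<open>Mean value theorem. With \<open>c = 0\<close> it yields monotonicity of
  \<open>V\<close>, with positive \<open>c\<close> the price of an interval on which the dissipation
  stays large.\<close>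

lemma lyapunov_decrease:
  fixes V :: "real \<Rightarrow> real"
  assumes "\<And>t. t \<ge> 0 \<Longrightarrow> (V has_vector_derivative V' t) (at t within {0..})"
    and "\<And>t. 0 \<le> t \<Longrightarrow> V' t \<le> - d t"
    and "0 \<le> s" "s \<le> t" and "\<And>u. s \<le> u \<Longrightarrow> u \<le> t \<Longrightarrow> c \<le> d u"
  shows "V t \<le> V s - c * (t - s)"
proof (cases "s = t")
  case False
  have "((\<lambda>u. V u) has_derivative (\<lambda>h. h * V' u)) (at u within {s..t})" if "u \<in> {s..t}" for u
    using assms(1)[of u] that \<open>0 \<le> s\<close>
    by (auto simp: has_vector_derivative_def intro: has_derivative_subset)
  then obtain u where u: "u \<in> {s<..<t}" "V t - V s = (t - s) * V' u"
    using mvt_simple[of s t V "\<lambda>u h. h * V' u"] False assms by auto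
  have "V' u \<le> - c" using assms(2)[of u] assms(5)[of u] u(1) assms(3) by auto
  then have "(t - s) * V' u \<le> (t - s) * - c"
    using assms(4) by (intro mult_left_mono) auto
  then show ?thesis using u(2) by (simp add: algebra_simps)
qed simp

text \<open>A decreasing nonnegative function \<open>V\<close> is Cauchy at infinity, whereas each excursion of \<open>f\<close> to
  norm \<open>\<epsilon>\<close> lasts at least \<open>\<epsilon> / (2 C)\<close>, where \<open>C\<close> bounds the derivative of \<open>f\<close>, and costs a fixed
  amount of \<open>V\<close>.\<close>

lemma barbalat_lyapunov:
  fixes f :: "real \<Rightarrow> 'a::euclidean_space" and V :: "real \<Rightarrow> real"
  assumes V: "\<And>t. t \<ge> 0 \<Longrightarrow> (V has_vector_derivative V' t) (at t within {0..})"
    and V_nonneg: "\<And>t. t \<ge> 0 \<Longrightarrow> 0 \<le> V t"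
    and c: "c > 0" "\<And>t. t \<ge> 0 \<Longrightarrow> V' t \<le> - (c * (norm (f t))\<^sup>2)"
    and f: "\<And>t. t \<ge> 0 \<Longrightarrow> (f has_vector_derivative f' t) (at t within {0..})"
    and f': "bounded_signal f'"
  shows "(f \<longlongrightarrow> 0) at_top"
proof (rule tendstoI)
  fix \<epsilon> :: real assume \<epsilon>: "\<epsilon> > 0"
  obtain C where C: "C > 0" "\<And>t. t \<ge> 0 \<Longrightarrow> norm (f' t) \<le> C"
    using bounded_signalE[OF f'] by metis
  define h where "h = \<epsilon> / (2 * C)"
  define \<eta> where "\<eta> = c * (\<epsilon> / 2)\<^sup>2 * h"
  have h: "h > 0" and \<eta>: "\<eta> > 0" using \<epsilon> C c by (auto simp: h_def \<eta>_def)
  let ?I = "Inf (V ` {0..})"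
  have bdd: "bdd_below (V ` {0..})" using V_nonneg by (auto intro!: bdd_belowI)
  \<comment> \<open>From \<open>T\<close> on, \<open>V\<close> can lose less than \<eta>, the price
    of a single excursion.\<close>
  have "?I < ?I + \<eta>" using \<eta> by simp
  then obtain T where T: "T \<ge> 0" "V T < ?I + \<eta>"
    using cInf_lessD[of "V ` {0..}" "?I + \<eta>"] by auto
  have "norm (f t) < \<epsilon>" if t: "t \<ge> T" for t
  proof (rule ccontr)
    assume "\<not> norm (f t) < \<epsilon>"
    then have ge: "norm (f t) \<ge> \<epsilon>" by simp
    have "c * (\<epsilon> / 2)\<^sup>2 \<le> c * (norm (f u))\<^sup>2" if u: "t \<le> u" "u \<le> t + h" for u
    proof -
      have "norm (f u - f t) \<le> C * (u - t)"
        using vector_derivative_lipschitz[of "{0..}" f f' C t u] f C(2) t T u by auto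
      also have "\<dots> \<le> C * h" using C u by (intro mult_left_mono) auto
      also have "\<dots> = \<epsilon> / 2" using C by (simp add: h_def)
      finally have "norm (f u) \<ge> \<epsilon> / 2"
        using ge norm_triangle_ineq2[of "f t" "f u"] by (simp add: norm_minus_commute)
      then show ?thesis using c \<epsilon> by (intro mult_left_mono power_mono) auto
    qed
    then have "V (t + h) \<le> V t - c * (\<epsilon> / 2)\<^sup>2 * (t + h - t)"
      using t T h by (intro lyapunov_decrease[OF V c(2)]) auto
    moreover have "V t \<le> V T - 0 * (t - T)"
      using t T c(1) by (intro lyapunov_decrease[OF V c(2)]) auto
    moreover have "?I \<le> V (t + h)" using bdd t T h by (intro cInf_lower) auto
    ultimately show False using T by (simp add: \<eta>_def)
  qed
  then show "\<forall>\<^sub>F t in at_top. dist (f t) 0 < \<epsilon>"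
    by (auto simp: eventually_at_top_linorder)
qed

text \<open>On unit intervals \<open>f\<close> moves by \<open>g + o(1)\<close>, so \<open>f \<rightarrow> 0\<close> forces \<open>g \<rightarrow> 0\<close>.\<close>

lemma tendsto_zero_of_derivative_split:
  fixes f g r :: "real \<Rightarrow> 'a::euclidean_space"
  assumes f: "\<And>t. t \<ge> 0 \<Longrightarrow> (f has_vector_derivative (g t + r t)) (at t within {0..})"
    and g: "\<And>t. t \<ge> 0 \<Longrightarrow> (g has_vector_derivative g' t) (at t within {0..})"
    and lim: "(f \<longlongrightarrow> 0) at_top" "(r \<longlongrightarrow> 0) at_top" "(g' \<longlongrightarrow> 0) at_top"
  shows "(g \<longlongrightarrow> 0) at_top"
proof (rule tendstoI)
  fix \<epsilon> :: real assume \<epsilon>: "\<epsilon> > 0"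
  \<comment> \<open>The estimate of \<open>g t\<close> collects two values of \<open>f\<close>, the
    variation of \<open>g\<close> and the remainder \<open>r\<close>, each at most \<eta>, so their
    sum stays below \<epsilon>.\<close>
  define \<eta> where "\<eta> = \<epsilon> / 5"
  have \<eta>: "\<eta> > 0" using \<epsilon> by (simp add: \<eta>_def)
  have "\<forall>\<^sub>F t in at_top. norm (f t) < \<eta> \<and> norm (r t) < \<eta> \<and> norm (g' t) < \<eta> \<and> t \<ge> 0"
    using lim[THEN tendstoD, OF \<eta>] eventually_ge_at_top[of 0] by eventually_elim auto
  then obtain T where T: "\<And>t. t \<ge> T \<Longrightarrow> norm (f t) < \<eta> \<and> norm (r t) < \<eta> \<and> norm (g' t) < \<eta> \<and> t \<ge> 0"
    by (auto simp: eventually_at_top_linorder)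
  have "norm (g t) < \<epsilon>" if t: "t \<ge> T" for t
  proof -
    have t0: "t \<ge> 0" using T t by blast
    have sub: "{t..t+1} \<subseteq> {0..}" using t0 by auto
    have g_near: "norm (g u - g t) \<le> \<eta>" if u: "u \<in> {t..t+1}" for u
    proof -
      have "norm (g u - g t) \<le> \<eta> * \<bar>u - t\<bar>"
      proof (rule vector_derivative_lipschitz)
        show "(g has_vector_derivative g' v) (at v within {t..t+1})" if "v \<in> {t..t+1}" for v
          using g[of v] that t0 sub by (auto intro: has_vector_derivative_within_subset)
        show "norm (g' v) \<le> \<eta>" if "v \<in> {t..t+1}" for v
          using T[of v] that t by auto
      qed (use u in auto)
      also have "\<dots> \<le> \<eta> * 1" using u \<eta> by (intro mult_left_mono) auto
      finally show ?thesis by simp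
    qed
    \<comment> \<open>Subtracting the linear function of slope \<open>g t\<close> leaves a function
      whose derivative is small on the whole unit interval.\<close>
    let ?k = "\<lambda>u. f u - u *\<^sub>R g t"
    have "norm (?k (t + 1) - ?k t) \<le> 2 * \<eta> * \<bar>t + 1 - t\<bar>"
    proof (rule vector_derivative_lipschitz)
      fix u assume u: "u \<in> {t..t+1}"
      have "(?k has_vector_derivative (g u + r u - g t)) (at u within {0..})"
        using f[of u] u t0 by (auto intro!: derivative_eq_intros)
      then show "(?k has_vector_derivative (g u + r u - g t)) (at u within {t..t+1})"
        using sub by (rule has_vector_derivative_within_subset)
      have "norm (g u + r u - g t) \<le> norm (g u - g t) + norm (r u)"
        using norm_triangle_ineq[of "g u - g t" "r u"] by (simp add: algebra_simps)
      also have "\<dots> \<le> 2 * \<eta>" using g_near[OF u] T[of u] u t by auto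
      finally show "norm (g u + r u - g t) \<le> 2 * \<eta>" .
    qed auto
    then have "norm (f (t + 1) - f t - g t) \<le> 2 * \<eta>" by (simp add: algebra_simps)
    moreover have "norm (f (t + 1)) < \<eta>" "norm (f t) < \<eta>" using T t by auto
    moreover have "norm (g t) \<le> norm (f (t + 1)) + norm (f t) + norm (f (t + 1) - f t - g t)"
      by norm
    ultimately show ?thesis using \<epsilon> by (simp add: \<eta>_def)
  qed
  then show "\<forall>\<^sub>F t in at_top. dist (g t) 0 < \<epsilon>"
    by (auto simp: eventually_at_top_linorder)
qed

section \<open>Rotations and the inertia matrix\<close>

text \<open>Crossing with a unit vector is a quarter turn of its normal plane, which contains
  \<open>r \<times> w\<close>; two further quarter turns reverse that vector.\<close>

lemma cross_cross_cross_unit: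
  assumes "norm r = 1"
  shows "r \<times> (r \<times> (r \<times> w)) = - (r \<times> w)"
  using assms by (simp add: Lagrange[of r r] Lagrange[of r r "r \<times> w"] dot_cross_self cross_mult_right
      Cross3.right_diff_distrib flip: power2_norm_eq_inner)

lemma rotation_inner:
  fixes R :: "real^'n^'n"
  assumes "rotation_matrix R"
  shows "(R *v v) \<bullet> (R *v w) = v \<bullet> w"
proof -
  have "(R *v v) \<bullet> (R *v w) = (transpose R *v (R *v v)) \<bullet> w"
    unfolding transpose_matrix_vector by (rule dot_lmul_matrix[symmetric])
  also have "transpose R *v (R *v v) = v"
    using assms
    by (simp add: matrix_vector_mul_assoc rotation_matrix_def orthogonal_matrix_def
        del: transpose_matrix_vector)
  finally show ?thesis .
qed

lemma rotation_transpose: "rotation_matrix R \<Longrightarrow> R *v (transpose R *v v) = v"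
  by (simp add: matrix_vector_mul_assoc rotation_matrix_def orthogonal_matrix_def
      del: transpose_matrix_vector)

lemma norm_r3: "rotation_matrix (att y) \<Longrightarrow> norm (r3 y) = 1"
  by (simp add: r3_def norm_eq_sqrt_inner rotation_inner)

text \<open>Two moments of inertia coincide, so the inertia matrix acts as a scalar on the plane
  with vanishing third component, where the control torque lies.\<close>

lemma matrix_inv_inertia:
  assumes "valid_params P" "y $ 3 = 0"
  shows "matrix_inv (inertia P) *v y = (1 / jperp P) *\<^sub>R y"
proof -
  have pos: "jperp P > 0" "jpar P > 0"
    using assms(1) by (auto simp: valid_params_def)
  let ?I = "(\<chi> i j. if i = j then (if i = 3 then 1 / jpar P else 1 / jperp P) else 0) :: real^3^3"
  have "inertia P ** ?I = mat 1"
    using pos by (simp add: inertia_def matrix_matrix_mult_def mat_def vec_eq_iff sum_3 forall_3)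
  moreover have "?I ** inertia P = mat 1"
    using pos by (simp add: inertia_def matrix_matrix_mult_def mat_def vec_eq_iff sum_3 forall_3)
  \<comment> \<open>\<open>matrix_inv\<close> is an arbitrary choice of a two-sided inverse, so
    \<open>?I\<close> serves only as a witness of existence.\<close>
  ultimately have "\<exists>A. inertia P ** A = mat 1 \<and> A ** inertia P = mat 1"
    by blast
  then have "matrix_inv (inertia P) ** inertia P = mat 1"
    unfolding matrix_inv_def by (rule someI2_ex) simp
  then have "matrix_inv (inertia P) *v (inertia P *v y) = y"
    by (simp add: matrix_vector_mul_assoc)
  moreover have "inertia P *v y = jperp P *\<^sub>R y"
    using assms(2) by (simp add: inertia_def matrix_vector_mult_def vec_eq_iff sum_3 forall_3)
  ultimately have "jperp P *\<^sub>R (matrix_inv (inertia P) *v y) = y"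
    by (simp add: matrix_vector_mult_scaleR)
  then have "(1 / jperp P) *\<^sub>R y = (1 / jperp P) *\<^sub>R (jperp P *\<^sub>R (matrix_inv (inertia P) *v y))"
    by simp
  then show ?thesis using pos by simp
qed

section \<open>The regressor of the third adaptation law\<close>

text \<open>Overwriting \<open>bh3\<close> is the device by which the unknown disturbance is
  inserted into the \<open>bar\<close> quantities; their other ingredients must survive it
  unchanged.\<close>

lemma bh3_indep [simp]:
  "r3 (y\<lparr>bh3 := \<beta>\<rparr>) = r3 y" "Om12 (y\<lparr>bh3 := \<beta>\<rparr>) = Om12 y" "dr3 (y\<lparr>bh3 := \<beta>\<rparr>) = dr3 y"
  "z1 P pd t (y\<lparr>bh3 := \<beta>\<rparr>) = z1 P pd t y" "z2 P pd t (y\<lparr>bh3 := \<beta>\<rparr>) = z2 P pd t y"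
  "err P pd t (y\<lparr>bh3 := \<beta>\<rparr>) = err P pd t y"
  "xi P pd t (y\<lparr>bh3 := \<beta>\<rparr>) = xi P pd t y" "r3d P pd t (y\<lparr>bh3 := \<beta>\<rparr>) = r3d P pd t y"
  "u3_bar P pd t (y\<lparr>bh3 := \<beta>\<rparr>) = u3_bar P pd t y" "z_r P pd t (y\<lparr>bh3 := \<beta>\<rparr>) = z_r P pd t y"
  "dbh1 P pd t (y\<lparr>bh3 := \<beta>\<rparr>) = dbh1 P pd t y"
  "dz2_hat P pd t (y\<lparr>bh3 := \<beta>\<rparr>) = dz2_hat P pd t y"
  "dxi_hat P pd t (y\<lparr>bh3 := \<beta>\<rparr>) = dxi_hat P pd t y"
  "dr3d_hat P pd t (y\<lparr>bh3 := \<beta>\<rparr>) = dr3d_hat P pd t y"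
  "Om12d_hat P pd t (y\<lparr>bh3 := \<beta>\<rparr>) = Om12d_hat P pd t y"
  "Xi P pd t (y\<lparr>bh3 := \<beta>\<rparr>) = Xi P pd t y"
  "dbh2 P pd t (y\<lparr>bh3 := \<beta>\<rparr>) = dbh2 P pd t y"
  by (simp_all add: r3_def Om12_def Om_def dr3_def z1_def z2_def err_def xi_def zeta_def r3d_def
      u3_bar_def z_r_def dbh1_def dz2_hat_def dxi_hat_def dzeta_hat_def dr3d_hat_def Om12d_hat_def
      Xi_def dbh2_def p_del_def v_del_def)

section \<open>The antipodal set\<close>

lemma measurable_rotation_matrix: "{R :: real^3^3. rotation_matrix R} \<in> sets borel"
proof -
  have "{R :: real^3^3. rotation_matrix R} = {R. transpose R ** R = mat 1 \<and> det R = 1}"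
    by (auto simp: rotation_matrix_def orthogonal_matrix)
  moreover have "closed {R :: real^3^3. transpose R ** R = mat 1 \<and> det R = 1}"
    unfolding matrix_matrix_mult_def transpose_def det_3
    by (intro closed_Collect_conj closed_Collect_eq continuous_intros)
  ultimately show ?thesis by simp
qed

text \<open>For a fixed rotation, \<open>xi\<close> is affine in the remaining state variables and the estimate \<open>bh1\<close>
  enters it with coefficient one, so requiring \<open>xi\<close> to be parallel to \<open>r3\<close> confines these variables
  to a hyperplane.\<close>

lemma measure_zero_antipodal: "measure_zero_states (antipodal_states P pd)"
  unfolding measure_zero_states_def
proof (intro allI impI)
  fix \<mu> :: "(real^3^3) measure" and w :: "real^3"
  assume haar: "haar_SO3 \<mu>"
  define st :: "real^3^3 \<Rightarrow> (real^3) \<times> (real^3) \<times> (real^3) \<times> (real^3) \<times> (real^3) \<Rightarrow> state"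
    where "st R z = (case z of (p, v, b1, b2, b3) \<Rightarrow>
      \<lparr>pos = p, vel = v, att = R, angvel = w, bh1 = b1, bh2 = b2, bh3 = b3\<rparr>)" for R z
  define A where "A = {y. st (fst y) (snd y) \<in> antipodal_states P pd}"
  \<comment> \<open>The part of \<open>xi\<close> at time \<open>0\<close> that depends on the
    attitude alone, the body angular velocity \<open>w\<close> being fixed.\<close>
  define k where "k R = - (delta P *\<^sub>R (Nmat P *v (R *v e3))) - Nmat P *v pd 0
     - Mmat P *v tderiv 1 pd 0 + delta P *\<^sub>R (Mmat P *v ((R *v e3) \<times>
        - ((R *v e3) \<times> ((R *v e3) \<times> (R *v w))))) + grav P *\<^sub>R e3 - tderiv 2 pd 0" for R
  have r3_st: "r3 (st R z) = R *v e3" for R z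
    by (simp add: r3_def st_def split: prod.split)
  have xi_st: "xi P pd 0 (st R (p, v, b1, b2, b3)) = Nmat P *v p + Mmat P *v v + b1 + k R" for R p v b1 b2 b3
    by (simp add: xi_def zeta_def z1_def z2_def p_del_def v_del_def r3_def Om12_def Om_def st_def k_def
        skew_mult_vec skew2_mult_vec matrix_vector_mult_uminus_right algebra_simps)
  have A: "A \<in> sets borel"
  proof -
    let ?\<xi> = "\<lambda>y. xi P pd 0 (st (fst y) (snd y))"
    \<comment> \<open>Normalising \<open>xi\<close> is discontinuous at zero, so the condition is
      treated as the zero set of a Borel function and not as a closed set.\<close>
    let ?g = "\<lambda>y. fst y *v e3 + (1 / norm (?\<xi> y)) *\<^sub>R ?\<xi> y"
    note mv = bounded_bilinear.continuous_on[OF bounded_bilinear_mat_vec]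
    have "continuous_on UNIV (\<lambda>y :: (real^3^3) \<times> (real^3) \<times> (real^3) \<times> (real^3) \<times> (real^3) \<times> (real^3). Nmat P *v fst (snd y) + Mmat P *v fst (snd (snd y))
        + fst (snd (snd (snd y))) + k (fst y) :: real^3)"
      unfolding k_def by (intro continuous_intros mv continuous_on_cross)
    moreover have "?\<xi> = (\<lambda>y. Nmat P *v fst (snd y) + Mmat P *v fst (snd (snd y))
        + fst (snd (snd (snd y))) + k (fst y))"
      by (auto simp: xi_st)
    ultimately have [measurable]: "?\<xi> \<in> borel_measurable borel"
      by (simp add: borel_measurable_continuous_onI)
    have [measurable]: "(\<lambda>y :: (real^3^3) \<times> (real^3) \<times> (real^3) \<times> (real^3) \<times> (real^3) \<times> (real^3). fst y *v e3) \<in> borel_measurable borel"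
      by (intro borel_measurable_continuous_onI continuous_intros mv)
    have "?g \<in> borel_measurable borel" by measurable
    then have "?g -` {0} \<in> sets borel"
      using measurable_sets[of ?g borel borel "{0}"] by simp
    moreover have "fst -` {R. rotation_matrix R} \<in> sets (borel :: ((real^3^3) \<times> (real^3) \<times> (real^3) \<times> (real^3) \<times> (real^3) \<times> (real^3)) measure)"
      using measurable_sets[OF borel_measurable_continuous_onI[OF continuous_on_fst[OF continuous_on_id]]
          measurable_rotation_matrix] by simp
    moreover have "A = fst -` {R. rotation_matrix R} \<inter> ?g -` {0}"
      by (auto simp: A_def antipodal_states_def r3d_def r3_st eq_neg_iff_add_eq_0)
        (auto simp: st_def)
    ultimately show ?thesis by simp
  qed
  have "sets (\<mu> \<Otimes>\<^sub>M (lborel :: ((real^3) \<times> (real^3) \<times> (real^3) \<times> (real^3) \<times> (real^3)) measure)) = sets (borel \<Otimes>\<^sub>M borel)"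
    using haar by (intro sets_pair_measure_cong) (auto simp: haar_SO3_def)
  then have A': "A \<in> sets (\<mu> \<Otimes>\<^sub>M lborel)"
    using A unfolding borel_prod by blast
  \<comment> \<open>Integration over the attitude reduces the claim to Lebesgue nullity of every
    slice at a fixed attitude.\<close>
  have slice: "emeasure lborel (Pair R -` A) = 0" for R
  proof (cases "rotation_matrix R")
    case False
    then have "Pair R -` A = {}"
      by (auto simp: A_def antipodal_states_def st_def)
    then show ?thesis by simp
  next
    case True
    define r where "r = R *v e3"
    have "norm r = 1"
      using True norm_r3[of "st R 0"] unfolding r3_st r_def by (simp add: st_def zero_prod_def)
    then have "r \<noteq> 0" by auto
    then obtain n where n: "n \<noteq> 0" "n \<bullet> r = 0"
      using cross_basis_nonzero[of r] dot_cross_self by metis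
    \<comment> \<open>Coefficients of \<open>n \<bullet> xi\<close> as an affine functional of the
      Euclidean variables. The entry belonging to \<open>bh1\<close> is \<open>n\<close> itself, so
      the normal vector is nonzero.\<close>
    let ?a = "(n v* Nmat P, n v* Mmat P, n, 0 :: real^3, 0 :: real^3)"
    have "Pair R -` A \<subseteq> {z. ?a \<bullet> z = - (n \<bullet> k R)}"
    proof clarify
      fix p v b1 b2 b3 assume "(R, p, v, b1, b2, b3) \<in> A"
      then have r: "r = - ((1 / norm (xi P pd 0 (st R (p, v, b1, b2, b3)))) *\<^sub>R xi P pd 0 (st R (p, v, b1, b2, b3)))"
        by (simp add: A_def antipodal_states_def r3d_def r3_st r_def)
      have "n \<bullet> xi P pd 0 (st R (p, v, b1, b2, b3)) = 0"
        using n(2) by (subst (asm) r) auto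
      then show "?a \<bullet> (p, v, b1, b2, b3) = - (n \<bullet> k R)"
        by (simp add: xi_st inner_add_right dot_lmul_matrix)
    qed
    moreover have "negligible {z. ?a \<bullet> z = - (n \<bullet> k R)}"
      using n(1) by (intro negligible_hyperplane) (auto simp: zero_prod_def)
    ultimately have "negligible (Pair R -` A)"
      using negligible_subset by blast
    moreover have "Pair R -` A \<in> sets borel"
      using sets_Pair1[OF A', of R] by simp
    ultimately show ?thesis
      by (simp add: negligible_iff_null_sets null_sets_def)
  qed
  have "emeasure (\<mu> \<Otimes>\<^sub>M lborel) A = 0"
    by (subst lborel.emeasure_pair_measure_alt[OF A']) (simp add: slice)
  moreover have "A = {(R, p, v, b1, b2, b3).
          \<lparr>pos = p, vel = v, att = R, angvel = w, bh1 = b1, bh2 = b2, bh3 = b3\<rparr> \<in> antipodal_states P pd}"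
    by (auto simp: A_def st_def)
  ultimately show "{(R, p, v, b1, b2, b3).
          \<lparr>pos = p, vel = v, att = R, angvel = w, bh1 = b1, bh2 = b2, bh3 = b3\<rparr> \<in> antipodal_states P pd}
       \<in> null_sets (\<mu> \<Otimes>\<^sub>M lborel)"
    using A' by (simp add: null_sets_def)
qed

text \<open>The \<open>bar\<close> quantities are affine in the third estimate, and a change
  \<open>d\<close> of it is followed through their chain of definitions. The negated responses of
  \<open>ddxi_bar\<close>, \<open>dr3d_bar\<close>, \<open>ddr3d_bar\<close> and
  \<open>dOm12d_bar\<close> are given by \<open>Theta1\<close>, \<open>Theta2\<close>,
  \<open>Theta3\<close> and \<open>Theta4\<close>.\<close>

lemma dOm12c_bar_diff:
  "dOm12c_bar P pd t y - dOm12c_bar P pd t (y\<lparr>bh3 := \<beta>\<rparr>) = Theta P pd t y *v (bh3 y - \<beta>)"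
proof -
  let ?y = "y\<lparr>bh3 := \<beta>\<rparr>"
  define d where "d = bh3 y - \<beta>"
  define q where "q = 1 / norm (xi P pd t y)"
  define r rd where "r = r3 y" and "rd = r3d P pd t y"
  define M where "M = Mmat P"
  define x' where "x' = dxi_hat P pd t y"
  have dz2: "dz2_bar P pd t y = dz2_bar P pd t ?y + d"
    by (simp add: dz2_bar_def d_def)
  have derr: "derr_bar P pd t y = derr_bar P pd t ?y + d"
    by (simp add: derr_bar_def dz2)
  have dxi: "dxi_bar P pd t y = dxi_bar P pd t ?y + M *v d"
    by (simp add: dxi_bar_def dzeta_bar_def dz2 mat_vec_simps M_def)
  have T2: "Theta2 P pd t y *v d = q *\<^sub>R (rd \<times> (rd \<times> (M *v d)))"
    by (simp add: Theta2_def mat_vec_simps skew2_mult_vec q_def rd_def M_def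
        flip: matrix_vector_mul_assoc)
  have dr3d: "dr3d_bar P pd t y = dr3d_bar P pd t ?y - Theta2 P pd t y *v d"
    unfolding T2 by (simp add: dr3d_bar_def dxi skew2_mult_vec cross_add_right scaleR_add_right q_def rd_def)
  have dzr: "dz_r_bar P pd t y = dz_r_bar P pd t ?y + r \<times> (Theta2 P pd t y *v d)"
    by (simp add: dz_r_bar_def dr3d skew_mult_vec Cross3.right_diff_distrib r_def)
  have du3: "du3_bar_bar P pd t y = du3_bar_bar P pd t ?y - r \<bullet> (M *v d)"
    by (simp add: du3_bar_bar_def dxi inner_add_right r_def)
  have ddz2: "ddz2_bar P pd t y = ddz2_bar P pd t ?y - (r \<bullet> (M *v d)) *\<^sub>R r"
    by (simp add: ddz2_bar_def du3 r_def algebra_simps)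
  have T1: "Theta1 P pd t y *v d
      = (r \<bullet> (M *v d)) *\<^sub>R (M *v r) - Nmat P *v d - Lam1 P *v d"
    by (simp add: Theta1_def Nmat_def mat_vec_simps outer_mult_vec r_def M_def
        flip: matrix_vector_mul_assoc)
  have ddxi: "ddxi_bar P pd t y = ddxi_bar P pd t ?y - Theta1 P pd t y *v d"
    unfolding T1 by (simp add: ddxi_bar_def ddzeta_bar_def dz2 ddz2 derr mat_vec_simps M_def)
  define a where "a = Theta2 P pd t y *v d"
  \<comment> \<open>By the triple product identity, the outer products in \<open>Theta3\<close>
    encode, up to sign, the variation of \<open>rd \<times> (rd \<times> x')\<close> when
    \<open>rd\<close> moves along \<open>a\<close>.\<close>
  have key: "(2 * (rd \<bullet> a)) *\<^sub>R x' - (x' \<bullet> a) *\<^sub>R rd - (rd \<bullet> x') *\<^sub>R a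
      = - (a \<times> (rd \<times> x') + rd \<times> (a \<times> x'))"
    unfolding Lagrange mult_2 scaleR_add_left by (simp add: inner_commute)
  have "Theta3 P pd t y *v d =
      q *\<^sub>R ((2 * (rd \<bullet> a)) *\<^sub>R x' - (x' \<bullet> a) *\<^sub>R rd - (rd \<bullet> x') *\<^sub>R a)
      - q *\<^sub>R (rd \<times> (rd \<times> (Theta1 P pd t y *v d)))
      - (q\<^sup>2 * (rd \<bullet> (M *v d))) *\<^sub>R (rd \<times> (rd \<times> x'))"
    by (simp add: Theta3_def mat_vec_simps outer_mult_vec skew2_mult_vec q_def rd_def M_def x'_def a_def
        cross_mult_right power_one_over flip: matrix_vector_mul_assoc)
  note T3 = this[unfolded key]
  have ddr3d: "ddr3d_bar P pd t y = ddr3d_bar P pd t ?y - Theta3 P pd t y *v d"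
    unfolding T3
    by (simp add: ddr3d_bar_def dxi ddxi dr3d mat_vec_simps skew_mult_vec skew2_mult_vec
        cross_add_right cross_add_left Cross3.left_diff_distrib Cross3.right_diff_distrib
        q_def rd_def[symmetric] x'_def[symmetric] a_def[symmetric] inner_add_right
        scaleR_add_right scaleR_diff_right scaleR_add_left add_divide_distrib power_one_over
        flip: matrix_vector_mul_assoc)
  have dOmd: "dOm12d_bar P pd t y = dOm12d_bar P pd t ?y - Theta4 P pd t y *v d"
    by (simp add: dOm12d_bar_def Theta4_def dr3d ddr3d mat_vec_simps skew_mult_vec
        Cross3.right_diff_distrib flip: matrix_vector_mul_assoc)
  have T: "Theta P pd t y *v d = - ((kr P / hr P) *\<^sub>R (r \<times> (Theta2 P pd t y *v d)))
      + r \<times> (r \<times> (Theta4 P pd t y *v d))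
      + (norm (xi P pd t y) / hr P) *\<^sub>R (r \<times> d)
      + ((rd \<bullet> (M *v d)) / hr P) *\<^sub>R (r \<times> err P pd t y)"
    by (simp add: Theta_def mat_vec_simps outer_mult_vec skew_mult_vec skew2_mult_vec r_def rd_def M_def
        cross_mult_right flip: matrix_vector_mul_assoc)
  show ?thesis
    unfolding d_def[symmetric] T
    by (simp add: dOm12c_bar_def dxi derr dzr dOmd skew_mult_vec skew2_mult_vec mat_vec_simps
        cross_add_right Cross3.right_diff_distrib inner_add_right
        r_def[symmetric] rd_def[symmetric] divide_inverse algebra_simps
        flip: matrix_vector_mul_assoc)
qed

section \<open>Derivatives along the motion\<close>

locale tracking_loop =
  fixes P :: params and b :: "real^3" and pd :: "real \<Rightarrow> real^3" and u :: "real \<Rightarrow> real^3"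
    and x :: "real \<Rightarrow> state"
  assumes params: "valid_params P"
    and delta: "delta P = jperp P / (mass P * arm P)"
    and ref_C4: "C_class 4 pd"
    and ref_bounded: "\<And>k. 1 \<le> k \<Longrightarrow> k \<le> 4 \<Longrightarrow> bounded_signal (tderiv k pd)"
    and plant: "rigid_body_motion P b u x"
    and control: "\<And>t. 0 \<le> t \<Longrightarrow> u t = control_law P pd t (x t)"
    and adaptation: "adaptation_laws P pd x"
    and gyroscopic: "\<And>t. 0 \<le> t \<Longrightarrow> Gam0 P (x t) = 0"
    and xi_nonzero: "\<And>t. 0 \<le> t \<Longrightarrow> xi P pd t (x t) \<noteq> 0"
begin

text \<open>Evaluated at this state, the \<open>bar\<close> quantities are the true time derivatives along the motion.\<close>

abbreviation xb :: "real \<Rightarrow> state" where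
  "xb t \<equiv> (x t)\<lparr>bh3 := b\<rparr>"

lemma positive: "0 < mass P" "0 < arm P" "0 < jperp P" "0 < hr P" "0 < kr P" "0 < hOm P" "0 < kOm P"
  using params by (auto simp: valid_params_def)

context
  fixes t :: real assumes t: "0 \<le> t"
begin

section \<open>Equations of the plant, the estimates and the reference\<close>

lemma rot: "rotation_matrix (att (x t))"
  and pos_deriv: "((\<lambda>s. pos (x s)) has_vector_derivative vel (x t)) (at t within {0..})"
  and att_deriv: "((\<lambda>s. att (x s)) has_vector_derivative (att (x t) ** skew (angvel (x t)))) (at t within {0..})"
  and vel_deriv: "((\<lambda>s. vel (x s)) has_vector_derivative
          (grav P *\<^sub>R e3 + (1 / mass P) *\<^sub>R (att (x t) *v u t) + b)) (at t within {0..})"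
  and angvel_deriv: "((\<lambda>s. angvel (x s)) has_vector_derivative
          (- (matrix_inv (inertia P) *v (skew (angvel (x t)) *v (inertia P *v angvel (x t))))
           + arm P *\<^sub>R (matrix_inv (inertia P) *v (skew e3 *v u t)))) (at t within {0..})"
  using plant t by (auto simp: rigid_body_motion_def)

lemma bh_deriv:
  "((\<lambda>s. bh1 (x s)) has_vector_derivative dbh1 P pd t (x t)) (at t within {0..})"
  "((\<lambda>s. bh2 (x s)) has_vector_derivative dbh2 P pd t (x t)) (at t within {0..})"
  "((\<lambda>s. bh3 (x s)) has_vector_derivative dbh3 P pd t (x t)) (at t within {0..})"
  using adaptation t by (auto simp: adaptation_laws_def)

lemma ref_deriv:
  "(pd has_vector_derivative tderiv 1 pd t) (at t within {0..})"
  "(tderiv 1 pd has_vector_derivative tderiv 2 pd t) (at t within {0..})"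
  "(tderiv 2 pd has_vector_derivative tderiv 3 pd t) (at t within {0..})"
  "(tderiv 3 pd has_vector_derivative tderiv 4 pd t) (at t within {0..})"
proof -
  have *: "(tderiv i pd has_vector_derivative tderiv (Suc i) pd t) (at t within {0..})" if "i < 4" for i
    using ref_C4 that t
    by (auto simp: C_class_def tderiv_def vector_derivative_works[symmetric])
  show "(pd has_vector_derivative tderiv 1 pd t) (at t within {0..})"
    using *[of 0] by (simp add: tderiv_def)
  show "(tderiv 1 pd has_vector_derivative tderiv 2 pd t) (at t within {0..})"
    "(tderiv 2 pd has_vector_derivative tderiv 3 pd t) (at t within {0..})"
    "(tderiv 3 pd has_vector_derivative tderiv 4 pd t) (at t within {0..})"
    using *[of 1] *[of 2] *[of 3] by (simp_all add: numeral_eq_Suc)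
qed

lemma unit_r3: "norm (r3 (x t)) = 1"
  using rot by (rule norm_r3)

lemma unit_r3d: "norm (r3d P pd t (x t)) = 1"
  using xi_nonzero[OF t] by (simp add: r3d_def)

lemma xi_eq: "xi P pd t (x t) = norm (xi P pd t (x t)) *\<^sub>R r3d P pd t (x t)"
  using xi_nonzero[OF t] by (simp add: r3d_def)

section \<open>Reduced attitude and control point\<close>

lemmas deriv_rules = has_vector_derivative_add has_vector_derivative_diff has_vector_derivative_minus
  has_vector_derivative_cross has_vector_derivative_mat_vec has_vector_derivative_inner
  has_vector_derivative_scaleR' has_vector_derivative_const

text \<open>Spin about the thrust axis does not move that axis, so \<open>Om12\<close> may be
  replaced by the full angular velocity.\<close>

lemma dr3_eq: "dr3 (x t) = Om (x t) \<times> r3 (x t)"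
  using unit_r3
  by (simp add: dr3_def Om12_def skew_mult_vec skew2_mult_vec cross_cross_cross_unit)
    (simp add: cross_skew[of "Om (x t)"])

lemma r3_deriv: "((\<lambda>s. r3 (x s)) has_vector_derivative dr3 (x t)) (at t within {0..})"
  unfolding dr3_eq unfolding r3_def Om_def
  by (rule has_vector_derivative_eq_rhs, (rule deriv_rules att_deriv)+)
    (simp add: skew_mult_vec cross_rotation_matrix[OF rot] flip: matrix_vector_mul_assoc)

text \<open>The rotation of the frame contributes the cross product of the angular velocity with
  itself, which vanishes. The torque lies in the plane on which the inertia acts as the scalar
  \<open>jperp P\<close>.\<close>

lemma Om_deriv: "((\<lambda>s. Om (x s)) has_vector_derivative
   (- (att (x t) *v (matrix_inv (inertia P) *v (skew (angvel (x t)) *v (inertia P *v angvel (x t)))))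
    + (arm P / jperp P) *\<^sub>R (r3 (x t) \<times> (att (x t) *v u t)))) (at t within {0..})"
proof -
  have "(e3 \<times> u t) $ 3 = 0"
    by (simp add: cross_components axis_def)
  then have "matrix_inv (inertia P) *v (e3 \<times> u t) = (1 / jperp P) *\<^sub>R (e3 \<times> u t)"
    using params by (rule matrix_inv_inertia[rotated])
  then show ?thesis
    unfolding Om_def
    by (intro has_vector_derivative_eq_rhs[OF has_vector_derivative_mat_vec[OF att_deriv angvel_deriv]])
      (simp add: skew_mult_vec mat_vec_simps r3_def cross_rotation_matrix[OF rot]
        flip: matrix_vector_mul_assoc)
qed

text \<open>By \<open>Gam0 = 0\<close> the projected gyroscopic acceleration equals
  \<open>(r \<bullet> w) *\<^sub>R (w \<times> r)\<close>. The motion of the plane onto which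
  \<open>Om12\<close> projects contributes the opposite term, so only the torque remains.\<close>

lemma Om12_deriv: "((\<lambda>s. Om12 (x s)) has_vector_derivative
    (arm P / jperp P) *\<^sub>R (r3 (x t) \<times> (att (x t) *v u t))) (at t within {0..})"
proof -
  define r w where "r = r3 (x t)" and "w = Om (x t)"
  define G where "G = att (x t) *v (matrix_inv (inertia P) *v (skew (angvel (x t)) *v (inertia P *v angvel (x t))))"
  define U where "U = att (x t) *v u t"
  have r: "norm r = 1" "r \<bullet> r = 1" using unit_r3 by (simp_all add: r_def flip: power2_norm_eq_inner)
  have Om12: "Om12 (x t) = w - (r \<bullet> w) *\<^sub>R r"
    by (simp add: Om12_def skew2_mult_vec Lagrange r flip: r_def w_def)
  have "jperp P *\<^sub>R (r \<times> (r \<times> (G - w \<times> Om12 (x t)))) = 0"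
    using gyroscopic[OF t] by (simp add: Gam0_def skew2_mult_vec skew_mult_vec G_def r_def w_def)
  then have "r \<times> (r \<times> G) = r \<times> (r \<times> (w \<times> Om12 (x t)))"
    using positive by (simp add: Cross3.right_diff_distrib)
  also have "\<dots> = (r \<bullet> w) *\<^sub>R (w \<times> r)"
    by (simp add: Om12 Cross3.right_diff_distrib cross_mult_right)
      (simp add: cross_skew[of w r] cross_cross_cross_unit r)
  finally have G: "r \<times> (r \<times> G) = (r \<bullet> w) *\<^sub>R (w \<times> r)" .
  have "((\<lambda>s. Om12 (x s)) has_vector_derivative
     - (r \<times> (r \<times> (- G + (arm P / jperp P) *\<^sub>R (r \<times> U)) + dr3 (x t) \<times> w) + dr3 (x t) \<times> (r \<times> w)))
     (at t within {0..})"
    unfolding Om12_def skew2_mult_vec r_def w_def G_def U_def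
    by (intro deriv_rules Om_deriv r3_deriv)
  also have "- (r \<times> (r \<times> (- G + (arm P / jperp P) *\<^sub>R (r \<times> U)) + dr3 (x t) \<times> w) + dr3 (x t) \<times> (r \<times> w))
    = (arm P / jperp P) *\<^sub>R (r \<times> U)"
    using r by (simp add: cross_add_right cross_mult_right cross_cross_cross_unit G
        Cross3.right_diff_distrib)
      (simp add: dr3_eq r_def[symmetric] w_def[symmetric] Lagrange[of r "w \<times> r" w] Lagrange[of "w \<times> r" r w] dot_cross_self)
  finally show ?thesis by (simp add: r_def U_def)
qed

lemma p_del_deriv: "((\<lambda>s. p_del P (x s)) has_vector_derivative v_del P (x t)) (at t within {0..})"
  unfolding p_del_def
  by (rule has_vector_derivative_eq_rhs, (rule deriv_rules pos_deriv r3_deriv)+) (simp add: v_del_def dr3_def)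

text \<open>In the inertial frame the input splits into a part orthogonal to the thrust axis, which
  steers the axis, and a part along it, which supplies the thrust.\<close>

lemma att_control:
  "att (x t) *v u t = (1 / arm P) *\<^sub>R ((att (x t) *v (transpose (att (x t)) *v Gam_c P pd t (x t))) \<times> r3 (x t))
    - (mass P * (xi P pd t (x t) \<bullet> r3 (x t) + delta P * (norm (Om12 (x t)))\<^sup>2)) *\<^sub>R r3 (x t)"
  unfolding control[OF t] control_law_def
  by (simp add: mat_vec_simps skew_mult_vec r3_def)
    (simp add: cross_rotation_matrix[OF rot] cross_skew[of e3] mat_vec_simps)

lemma Om12_closed_loop_deriv: "((\<lambda>s. Om12 (x s)) has_vector_derivative
    - ((1 / jperp P) *\<^sub>R (r3 (x t) \<times> (r3 (x t) \<times> Gam_c P pd t (x t))))) (at t within {0..})"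
  using Om12_deriv positive unfolding att_control
  by (simp add: Cross3.right_diff_distrib cross_mult_right rotation_transpose[OF rot]
      cross_skew[of "Gam_c P pd t (x t)"] del: transpose_matrix_vector)

text \<open>The choice of \<open>delta\<close> gives
  \<open>delta P * arm P / jperp P = 1 / mass P\<close>, so the lateral force cancels against the
  acceleration that its own torque gives the control point. The centripetal term is compensated by
  the quadratic term in the control law.\<close>

lemma v_del_deriv: "((\<lambda>s. v_del P (x s)) has_vector_derivative
    (grav P *\<^sub>R e3 + u3_bar P pd t (x t) *\<^sub>R r3 (x t) + b)) (at t within {0..})"
proof -
  define r U k where "r = r3 (x t)" and "U = att (x t) *v u t"
    and "k = xi P pd t (x t) \<bullet> r3 (x t) + delta P * (norm (Om12 (x t)))\<^sup>2"
  have r: "norm r = 1" "r \<bullet> r = 1" using unit_r3 by (simp_all add: r_def flip: power2_norm_eq_inner)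
  have "r \<bullet> U = - (mass P * k)"
    unfolding U_def att_control k_def[symmetric] using r
    by (simp add: r_def[symmetric] inner_diff_right dot_cross_self)
  then have rrU: "r \<times> (r \<times> U) = - ((mass P * k) *\<^sub>R r) - U"
    by (simp add: Lagrange r)
  have dO: "dr3 (x t) \<times> Om12 (x t) = (norm (Om12 (x t)))\<^sup>2 *\<^sub>R r"
  proof -
    have "Om12 (x t) \<bullet> r = 0"
      by (simp add: Om12_def skew2_mult_vec r_def inner_commute dot_cross_self)
    then show ?thesis
      by (simp add: dr3_def skew_mult_vec r_def[symmetric] cross_skew[of "r \<times> Om12 (x t)"] Lagrange
          power2_norm_eq_inner)
  qed
  have "((\<lambda>s. v_del P (x s)) has_vector_derivative
     (grav P *\<^sub>R e3 + (1 / mass P) *\<^sub>R U + b)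
     + delta P *\<^sub>R (r \<times> ((arm P / jperp P) *\<^sub>R (r \<times> U)) + dr3 (x t) \<times> Om12 (x t))) (at t within {0..})"
    unfolding v_del_def skew_mult_vec r_def U_def
    by (rule has_vector_derivative_eq_rhs, (rule deriv_rules vel_deriv Om12_deriv r3_deriv)+) simp
  also have "(grav P *\<^sub>R e3 + (1 / mass P) *\<^sub>R U + b)
     + delta P *\<^sub>R (r \<times> ((arm P / jperp P) *\<^sub>R (r \<times> U)) + dr3 (x t) \<times> Om12 (x t))
     = grav P *\<^sub>R e3 + (delta P * (norm (Om12 (x t)))\<^sup>2 - k) *\<^sub>R r + b"
    using positive by (simp add: cross_mult_right rrU dO delta scaleR_add_right scaleR_diff_right
        scaleR_diff_left)
  finally show ?thesis by (simp add: k_def u3_bar_def r_def)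
qed

section \<open>True derivatives of the errors and controller quantities\<close>

lemma z1_deriv: "((\<lambda>s. z1 P pd s (x s)) has_vector_derivative z2 P pd t (x t)) (at t within {0..})"
  unfolding z1_def z2_def by (intro deriv_rules p_del_deriv ref_deriv)

lemma z2_deriv: "((\<lambda>s. z2 P pd s (x s)) has_vector_derivative dz2_bar P pd t (xb t)) (at t within {0..})"
  unfolding z2_def
  by (rule has_vector_derivative_eq_rhs, (rule deriv_rules v_del_deriv ref_deriv)+) (simp add: dz2_bar_def dz2_hat_def)

lemma err_deriv: "((\<lambda>s. err P pd s (x s)) has_vector_derivative derr_bar P pd t (xb t)) (at t within {0..})"
  unfolding err_def
  by (rule has_vector_derivative_eq_rhs, (rule deriv_rules z1_deriv z2_deriv)+) (simp add: derr_bar_def)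

lemma xi_deriv: "((\<lambda>s. xi P pd s (x s)) has_vector_derivative dxi_bar P pd t (xb t)) (at t within {0..})"
  unfolding xi_def zeta_def
  by (rule has_vector_derivative_eq_rhs, (rule deriv_rules z1_deriv z2_deriv bh_deriv ref_deriv)+)
    (simp add: dxi_bar_def dzeta_bar_def dbh1_def)

lemma norm_xi_deriv: "((\<lambda>s. norm (xi P pd s (x s))) has_vector_derivative
    (r3d P pd t (x t) \<bullet> dxi_bar P pd t (xb t))) (at t within {0..})"
  using has_vector_derivative_norm[OF xi_deriv xi_nonzero[OF t]] by (simp add: r3d_def)

lemma inverse_norm_xi_deriv: "((\<lambda>s. 1 / norm (xi P pd s (x s))) has_vector_derivative
    - ((r3d P pd t (x t) \<bullet> dxi_bar P pd t (xb t)) / (norm (xi P pd t (x t)))\<^sup>2)) (at t within {0..})"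
  using has_vector_derivative_inverse_norm[OF xi_deriv xi_nonzero[OF t]]
  by (simp add: r3d_def power2_eq_square power3_eq_cube mult.assoc)

text \<open>Normalisation removes the radial part of the derivative; the projection orthogonal to
  the unit vector is minus a double cross product.\<close>

lemma r3d_deriv: "((\<lambda>s. r3d P pd s (x s)) has_vector_derivative dr3d_bar P pd t (xb t)) (at t within {0..})"
proof -
  define r q y where "r = r3d P pd t (x t)" and "q = 1 / norm (xi P pd t (x t))"
    and "y = dxi_bar P pd t (xb t)"
  have "((\<lambda>s. r3d P pd s (x s)) has_vector_derivative
     (1 / norm (xi P pd t (x t))) *\<^sub>R y + - ((r \<bullet> y) / (norm (xi P pd t (x t)))\<^sup>2) *\<^sub>R xi P pd t (x t))
      (at t within {0..})"
    unfolding r_def y_def r3d_def[of P pd _ "x _"]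
    by (intro deriv_rules xi_deriv inverse_norm_xi_deriv[unfolded r3d_def])
  also have "(1 / norm (xi P pd t (x t))) *\<^sub>R y + - ((r \<bullet> y) / (norm (xi P pd t (x t)))\<^sup>2) *\<^sub>R xi P pd t (x t)
     = q *\<^sub>R (y - (r \<bullet> y) *\<^sub>R r)"
    by (simp add: r_def q_def r3d_def scaleR_diff_right power2_eq_square)
  also have "\<dots> = dr3d_bar P pd t (xb t)"
    using unit_r3d by (simp add: dr3d_bar_def skew2_mult_vec Lagrange r_def q_def y_def
        scaleR_diff_right flip: power2_norm_eq_inner)
  finally show ?thesis .
qed

lemma z_r_deriv: "((\<lambda>s. z_r P pd s (x s)) has_vector_derivative dz_r_bar P pd t (xb t)) (at t within {0..})"
  unfolding z_r_def skew_mult_vec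
  by (rule has_vector_derivative_eq_rhs, (rule deriv_rules r3d_deriv r3_deriv)+)
    (simp add: dz_r_bar_def skew_mult_vec cross_skew[of "dr3d_bar P pd t (xb t)"])

lemma u3_bar_deriv: "((\<lambda>s. u3_bar P pd s (x s)) has_vector_derivative du3_bar_bar P pd t (xb t)) (at t within {0..})"
  unfolding u3_bar_def
  by (rule has_vector_derivative_eq_rhs, (rule deriv_rules xi_deriv r3_deriv)+)
    (simp add: du3_bar_bar_def inner_commute)

text \<open>A hatted quantity contains the second estimate as a state variable, so its derivative
  brings in \<open>dbh2\<close>; the disturbance enters through the motion of \<open>xi\<close> and
  appears as \<open>bh3\<close> of \<open>xb t\<close>.\<close>

lemma dz2_hat_deriv: "((\<lambda>s. dz2_hat P pd s (x s)) has_vector_derivative ddz2_bar P pd t (xb t)) (at t within {0..})"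
  unfolding dz2_hat_def
  by (rule has_vector_derivative_eq_rhs, (rule deriv_rules u3_bar_deriv r3_deriv bh_deriv ref_deriv)+)
    (simp add: ddz2_bar_def)

lemma dxi_hat_deriv: "((\<lambda>s. dxi_hat P pd s (x s)) has_vector_derivative ddxi_bar P pd t (xb t)) (at t within {0..})"
  unfolding dxi_hat_def dzeta_hat_def dbh1_def
  by (rule has_vector_derivative_eq_rhs, (rule deriv_rules dz2_hat_deriv z2_deriv err_deriv ref_deriv)+)
    (simp add: ddxi_bar_def ddzeta_bar_def)

lemma dr3d_hat_deriv: "((\<lambda>s. dr3d_hat P pd s (x s)) has_vector_derivative ddr3d_bar P pd t (xb t)) (at t within {0..})"
  unfolding dr3d_hat_def skew2_mult_vec
  by (rule has_vector_derivative_eq_rhs, (rule deriv_rules inverse_norm_xi_deriv r3d_deriv dxi_hat_deriv)+)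
    (simp add: ddr3d_bar_def skew_mult_vec skew2_mult_vec mat_vec_simps cross_add_right algebra_simps
      flip: matrix_vector_mul_assoc)

lemma Om12d_hat_deriv: "((\<lambda>s. Om12d_hat P pd s (x s)) has_vector_derivative dOm12d_bar P pd t (xb t)) (at t within {0..})"
  unfolding Om12d_hat_def skew_mult_vec
  by (rule has_vector_derivative_eq_rhs, (rule deriv_rules r3d_deriv dr3d_hat_deriv)+)
    (simp add: dOm12d_bar_def skew_mult_vec cross_skew[of "dr3d_bar P pd t (xb t)"])

lemma Om12c_deriv: "((\<lambda>s. Om12c P pd s (x s)) has_vector_derivative dOm12c_bar P pd t (xb t)) (at t within {0..})"
  unfolding Om12c_def skew_mult_vec skew2_mult_vec
  by (rule has_vector_derivative_eq_rhs, (rule deriv_rules z_r_deriv norm_xi_deriv r3_deriv err_deriv Om12d_hat_deriv)+)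
    (simp add: dOm12c_bar_def skew_mult_vec skew2_mult_vec mat_vec_simps cross_add_right algebra_simps
      flip: matrix_vector_mul_assoc)

end

end

section \<open>The Lyapunov function\<close>

text \<open>Crossing twice with a unit vector is minus the projection onto its normal plane, in
  which \<open>z\<close> already lies.\<close>

lemma inner_double_cross_orthogonal:
  assumes "norm r = 1" "z \<bullet> r = 0"
  shows "z \<bullet> (r \<times> (r \<times> y)) = - (z \<bullet> y)"
  using assms by (simp add: Lagrange inner_diff_right flip: power2_norm_eq_inner)

text \<open>Expresses the loss of alignment caused by a motion \<open>d\<close> of the target
  through the angular velocity \<open>rd \<times> d\<close>, projected as in \<open>Om12c\<close>,
  so that the feedforward can cancel it.\<close>

lemma inner_tangent_eq:
  assumes "norm r = 1" "norm rd = 1" "rd \<bullet> d = 0"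
  shows "- (r \<bullet> d) = (rd \<times> r) \<bullet> (r \<times> (r \<times> (rd \<times> d)))"
proof -
  have "(rd \<times> r) \<bullet> (r \<times> (r \<times> (rd \<times> d))) = - ((rd \<times> r) \<bullet> (rd \<times> d))"
    using assms(1) by (intro inner_double_cross_orthogonal) (simp_all add: dot_cross_self)
  also have "\<dots> = - (r \<bullet> d)"
    unfolding dot_cross using assms(2,3) by (simp flip: power2_norm_eq_inner)
  finally show ?thesis by simp
qed

lemma has_vector_derivative_quadratic:
  fixes L :: "real^'n^'n"
  assumes "transpose L = L" "(w has_vector_derivative w') (at t within S)"
  shows "((\<lambda>s. 1/2 * (w s \<bullet> (L *v w s))) has_vector_derivative (w' \<bullet> (L *v w t))) (at t within S)"
proof -
  have "((\<lambda>s. w s \<bullet> (L *v w s)) has_vector_derivative (w t \<bullet> (L *v w' + 0 *v w t) + w' \<bullet> (L *v w t)))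
      (at t within S)"
    by (intro has_vector_derivative_inner has_vector_derivative_mat_vec assms has_vector_derivative_const)
  moreover have "w t \<bullet> (L *v w') = w' \<bullet> (L *v w t)"
    using inner_mat_vec_commute[OF assms(1)] by (metis inner_commute)
  ultimately have "((\<lambda>s. w s \<bullet> (L *v w s)) has_vector_derivative 2 * (w' \<bullet> (L *v w t))) (at t within S)"
    by simp
  from has_vector_derivative_mult_right[OF this, of "1/2"] show ?thesis
    by simp
qed

lemma bounded_signal_of_sq:
  fixes f :: "real \<Rightarrow> 'a::real_normed_vector"
  assumes "c > 0" "\<And>t. t \<ge> 0 \<Longrightarrow> c * (norm (f t))\<^sup>2 \<le> K"
  shows "bounded_signal f"
proof -
  have "norm (f t) \<le> sqrt (K / c)" if "t \<ge> 0" for t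
    using assms(1) assms(2)[OF that] by (intro real_le_rsqrt) (simp add: field_simps)
  then show ?thesis by (auto simp: bounded_signal_iff)
qed

section \<open>Error dynamics and the levels of the Lyapunov function\<close>

context tracking_loop
begin

text \<open>Thrust along \<open>r3\<close> cancels only the component of \<open>xi\<close> in that
  direction. The gains in \<open>xi\<close> are made to leave \<open>- z1 - Kv e\<close>, and the
  double cross product is the deficit.\<close>

lemma derr_bar_eq:
  assumes t: "0 \<le> t"
  shows "derr_bar P pd t (xb t) = - z1 P pd t (x t) - Kv P *v err P pd t (x t) + (b - bh1 (x t))
     - r3 (x t) \<times> (r3 (x t) \<times> xi P pd t (x t))"
proof -
  have "r3 (x t) \<times> (r3 (x t) \<times> xi P pd t (x t)) = (r3 (x t) \<bullet> xi P pd t (x t)) *\<^sub>R r3 (x t) - xi P pd t (x t)"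
    using unit_r3[OF t] by (simp add: Lagrange flip: power2_norm_eq_inner)
  moreover have "xi P pd t (x t) = z1 P pd t (x t) + Kv P *v (Kp P *v z1 P pd t (x t))
    + Kp P *v z2 P pd t (x t) + Kv P *v z2 P pd t (x t) + grav P *\<^sub>R e3 + bh1 (x t) - tderiv 2 pd t"
    by (simp add: xi_def zeta_def Nmat_def Mmat_def mat_vec_simps flip: matrix_vector_mul_assoc)
  ultimately show ?thesis
    by (simp add: derr_bar_def dz2_bar_def dz2_hat_def u3_bar_def err_def mat_vec_simps inner_commute)
qed

definition lyap_diss :: "real \<Rightarrow> real" where
  "lyap_diss t = z1 P pd t (x t) \<bullet> (Kp P *v z1 P pd t (x t)) + err P pd t (x t) \<bullet> (Kv P *v err P pd t (x t))
     + kr P * (norm (z_r P pd t (x t)))\<^sup>2 + kOm P * (norm (z_Om P pd t (x t)))\<^sup>2"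

lemma z_r_orth: "z_r P pd t (x t) \<bullet> r3 (x t) = 0"
  by (simp add: z_r_def skew_mult_vec dot_cross_self)

text \<open>Each summand of \<open>Om12\<close> and \<open>Om12c\<close> is a cross product with
  \<open>r3\<close>. Hence the projection in the control law acts on \<open>z_Om\<close> by a mere
  sign.\<close>

lemma z_Om_orth: "z_Om P pd t (x t) \<bullet> r3 (x t) = 0"
  by (simp add: z_Om_def Om12_def Om12c_def skew_mult_vec skew2_mult_vec inner_diff_left inner_add_left
      z_r_orth dot_cross_self)

text \<open>\<open>L1\<close>, \<open>L2\<close>, \<open>L3\<close> are the inverse adaptation gains
  that weight the estimation errors.\<close>

context
  fixes L1 L2 L3 :: "real^3^3"
  assumes L: "pos_def_matrix L1" "pos_def_matrix L2" "pos_def_matrix L3"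
    and L_inv: "\<And>v. L1 *v (Lam1 P *v v) = v" "\<And>v. L2 *v (Lam2 P *v v) = v" "\<And>v. L3 *v (Lam3 P *v v) = v"
begin

lemma L_sym: "transpose L1 = L1" "transpose L2 = L2" "transpose L3 = L3"
  using L by (simp_all add: pos_def_matrix_def)

text \<open>The Lyapunov function is split by the levels of the cascade, each pairing tracking
  errors with one estimate. The identity matrix is written out so that every quadratic term falls
  under one derivative rule.\<close>

definition lyap_pos :: "real \<Rightarrow> real" where
  "lyap_pos t = 1/2 * (z1 P pd t (x t) \<bullet> (mat 1 *v z1 P pd t (x t)))
     + 1/2 * (err P pd t (x t) \<bullet> (mat 1 *v err P pd t (x t)))
     + 1/2 * ((b - bh1 (x t)) \<bullet> (L1 *v (b - bh1 (x t))))"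

definition lyap_dir :: "real \<Rightarrow> real" where
  "lyap_dir t = hr P * (1 - r3 (x t) \<bullet> r3d P pd t (x t))
     + 1/2 * ((b - bh2 (x t)) \<bullet> (L2 *v (b - bh2 (x t))))"

definition lyap_rate :: "real \<Rightarrow> real" where
  "lyap_rate t = hOm P * (1/2 * (z_Om P pd t (x t) \<bullet> (mat 1 *v z_Om P pd t (x t))))
     + 1/2 * ((b - bh3 (x t)) \<bullet> (L3 *v (b - bh3 (x t))))"

text \<open>The cross terms of \<open>z1\<close> and \<open>err\<close> cancel and the first
  adaptation law absorbs \<open>b - bh1\<close>. The thrust deficit remains, to be compensated by
  \<open>lyap_dir\<close>.\<close>

lemma lyap_pos_deriv:
  assumes t: "0 \<le> t"
  shows "(lyap_pos has_vector_derivative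
     - (z1 P pd t (x t) \<bullet> (Kp P *v z1 P pd t (x t))) - err P pd t (x t) \<bullet> (Kv P *v err P pd t (x t))
     - err P pd t (x t) \<bullet> (r3 (x t) \<times> (r3 (x t) \<times> xi P pd t (x t)))) (at t within {0..})"
proof -
  have b1_deriv: "((\<lambda>s. b - bh1 (x s)) has_vector_derivative - (Lam1 P *v err P pd t (x t))) (at t within {0..})"
    by (rule has_vector_derivative_eq_rhs, (rule deriv_rules bh_deriv t)+) (simp add: dbh1_def)
  have z2: "z2 P pd t (x t) = err P pd t (x t) - Kp P *v z1 P pd t (x t)"
    by (simp add: err_def)
  have adj: "(L1 *v (b - bh1 (x t))) \<bullet> (Lam1 P *v err P pd t (x t)) = (b - bh1 (x t)) \<bullet> err P pd t (x t)"
    unfolding inner_mat_vec_commute[OF L_sym(1)] by (simp add: L_inv)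
  show ?thesis
    unfolding lyap_pos_def[abs_def]
    by (rule has_vector_derivative_eq_rhs,
        (rule has_vector_derivative_add has_vector_derivative_quadratic transpose_mat L_sym
          z1_deriv err_deriv b1_deriv t)+)
      (simp add: adj derr_bar_eq[OF t] z2 inner_diff_left inner_add_left inner_diff_right inner_add_right
        inner_commute)
qed

text \<open>With \<open>Om12 = Om12c + z_Om\<close>, the three summands of \<open>Om12c\<close>
  yield the damping of \<open>z_r\<close>, the term opposite to the thrust deficit, and the
  cancellation of the hatted motion of \<open>r3d\<close>. The rest of that motion is linear in
  \<open>b - bh2\<close> and is absorbed by the second adaptation law.\<close>

lemma lyap_dir_deriv:
  assumes t: "0 \<le> t"
  shows "(lyap_dir has_vector_derivative
     hr P * (z_r P pd t (x t) \<bullet> z_Om P pd t (x t)) - kr P * (norm (z_r P pd t (x t)))\<^sup>2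
     + err P pd t (x t) \<bullet> (r3 (x t) \<times> (r3 (x t) \<times> xi P pd t (x t)))) (at t within {0..})"
proof -
  define r rd q n z e \<beta> where "r = r3 (x t)" and "rd = r3d P pd t (x t)" and "q = 1 / norm (xi P pd t (x t))"
    and "n = norm (xi P pd t (x t))" and "z = z_r P pd t (x t)" and "e = err P pd t (x t)" and "\<beta> = b - bh2 (x t)"
  have r: "norm r = 1" "norm rd = 1" using unit_r3[OF t] unit_r3d[OF t] by (simp_all add: r_def rd_def)
  have z: "z = rd \<times> r" by (simp add: z_def z_r_def rd_def r_def skew_mult_vec)
  have b2_deriv: "((\<lambda>s. b - bh2 (x s)) has_vector_derivative - dbh2 P pd t (x t)) (at t within {0..})"
    by (rule has_vector_derivative_eq_rhs, (rule deriv_rules bh_deriv t)+) simp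
  \<comment> \<open>The gain cancels against its inverse \<open>L2\<close>, and transposition moves
    the regressor onto the estimation error.\<close>
  have adj: "- dbh2 P pd t (x t) \<bullet> (L2 *v \<beta>) = hr P * (z \<bullet> (Xi P pd t (x t) *v \<beta>))"
  proof -
    have "- dbh2 P pd t (x t) \<bullet> (L2 *v \<beta>)
        = hr P * ((Lam2 P *v (transpose (Xi P pd t (x t)) *v z)) \<bullet> (L2 *v \<beta>))"
      by (simp add: dbh2_def z_def)
    also have "\<dots> = hr P * ((transpose (Xi P pd t (x t)) *v z) \<bullet> \<beta>)"
      using inner_mat_vec_commute[OF L_sym(2), of _ \<beta>] by (metis L_inv(2))
    also have "\<dots> = hr P * (z \<bullet> (Xi P pd t (x t) *v \<beta>))"
      by (simp add: dot_lmul_matrix)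
    finally show ?thesis .
  qed
  \<comment> \<open>The amount by which the true motion of \<open>r3d\<close> differs from the
    hatted one.\<close>
  define d where "d = - (q *\<^sub>R (rd \<times> (rd \<times> (Mmat P *v \<beta>))))"
  have "dxi_bar P pd t (xb t) = dxi_hat P pd t (x t) + Mmat P *v \<beta>"
    by (simp add: dxi_bar_def dxi_hat_def dzeta_bar_def dzeta_hat_def dz2_bar_def mat_vec_simps \<beta>_def)
  then have dr3d: "dr3d_bar P pd t (xb t) = dr3d_hat P pd t (x t) + d"
    by (simp add: dr3d_bar_def dr3d_hat_def skew2_mult_vec cross_add_right scaleR_add_right d_def q_def rd_def)
  have "rd \<bullet> d = 0" by (simp add: d_def dot_cross_self)
  note 1 = inner_tangent_eq[OF r this, folded z]
  have "rd \<times> d = q *\<^sub>R (rd \<times> (Mmat P *v \<beta>))"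
    by (simp add: d_def cross_mult_right cross_cross_cross_unit r)
  then have 2: "z \<bullet> (r \<times> (r \<times> (rd \<times> d))) = - (z \<bullet> (Xi P pd t (x t) *v \<beta>))"
    by (simp add: Xi_def mat_vec_simps skew2_mult_vec skew_mult_vec cross_mult_right r_def rd_def q_def
        flip: matrix_vector_mul_assoc)
  have "rd \<bullet> dr3d_hat P pd t (x t) = 0"
    by (simp add: dr3d_hat_def skew2_mult_vec rd_def dot_cross_self)
  note 3 = inner_tangent_eq[OF r this, folded z]
  have 4: "rd \<times> dr3d_hat P pd t (x t) = Om12d_hat P pd t (x t)"
    by (simp add: Om12d_hat_def skew_mult_vec rd_def)
  have 5: "dr3 (x t) \<bullet> rd = - (z \<bullet> Om12 (x t))"
    using cross_triple[of r "Om12 (x t)" rd] cross_triple[of "Om12 (x t)" rd r]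
    by (simp add: dr3_def skew_mult_vec r_def[symmetric] z)
  have 6: "z \<bullet> (r \<times> e) * n = e \<bullet> (r \<times> (r \<times> xi P pd t (x t)))"
  proof -
    have xi: "xi P pd t (x t) = n *\<^sub>R rd"
      unfolding n_def rd_def by (rule xi_eq[OF t])
    show ?thesis
      using r unfolding xi z dot_cross
      by (simp add: Lagrange inner_diff_right cross_mult_right inner_commute algebra_simps flip: power2_norm_eq_inner)
  qed
  have 7: "Om12 (x t) = z_Om P pd t (x t) - (kr P / hr P) *\<^sub>R z + (n / hr P) *\<^sub>R (r \<times> e)
     - r \<times> (r \<times> Om12d_hat P pd t (x t))"
    by (simp add: z_Om_def Om12c_def skew_mult_vec skew2_mult_vec n_def r_def e_def z_def)
  have "(lyap_dir has_vector_derivative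
      hr P * (0 - (r \<bullet> dr3d_bar P pd t (xb t) + dr3 (x t) \<bullet> rd)) + - dbh2 P pd t (x t) \<bullet> (L2 *v \<beta>))
      (at t within {0..})"
    unfolding lyap_dir_def[abs_def] r_def rd_def \<beta>_def
    by (intro has_vector_derivative_add has_vector_derivative_mult_right has_vector_derivative_diff
        has_vector_derivative_const has_vector_derivative_inner has_vector_derivative_quadratic
        L_sym b2_deriv r3_deriv r3d_deriv t)
  also have "hr P * (0 - (r \<bullet> dr3d_bar P pd t (xb t) + dr3 (x t) \<bullet> rd)) + - dbh2 P pd t (x t) \<bullet> (L2 *v \<beta>)
     = hr P * (z \<bullet> (r \<times> (r \<times> Om12d_hat P pd t (x t))) + z \<bullet> Om12 (x t))"
  proof -
    have "r \<bullet> d = z \<bullet> (Xi P pd t (x t) *v \<beta>)"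
      "r \<bullet> dr3d_hat P pd t (x t) = - (z \<bullet> (r \<times> (r \<times> Om12d_hat P pd t (x t))))"
      using 1 2 3 4 by simp_all
    then show ?thesis
      unfolding adj dr3d inner_add_right 5 by (simp add: algebra_simps)
  qed
  also have "\<dots> = hr P * (z \<bullet> z_Om P pd t (x t)) - kr P * (norm z)\<^sup>2 + z \<bullet> (r \<times> e) * n"
    unfolding 7 using positive
    by (simp add: inner_diff_right inner_add_right power2_norm_eq_inner field_simps)
  finally show ?thesis unfolding 6 by (simp add: r_def e_def z_def)
qed

text \<open>\<open>Gam_c\<close> damps \<open>z_Om\<close>, offsets the coupling with
  \<open>z_r\<close> and compensates the derivative of \<open>Om12c\<close> up to the error of the
  third estimate. That discrepancy is \<open>Theta\<close> applied to \<open>b - bh3\<close>, which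
  the third adaptation law absorbs.\<close>

lemma lyap_rate_deriv:
  assumes t: "0 \<le> t"
  shows "(lyap_rate has_vector_derivative
     - (hr P * (z_r P pd t (x t) \<bullet> z_Om P pd t (x t))) - kOm P * (norm (z_Om P pd t (x t)))\<^sup>2) (at t within {0..})"
proof -
  define r zr zO \<beta> D D' \<Gamma> where "r = r3 (x t)" and "zr = z_r P pd t (x t)" and "zO = z_Om P pd t (x t)"
    and "\<beta> = b - bh3 (x t)" and "D = dOm12c_bar P pd t (x t)" and "D' = dOm12c_bar P pd t (xb t)"
    and "\<Gamma> = Gam_c P pd t (x t)"
  note orth = inner_double_cross_orthogonal[OF unit_r3[OF t] z_Om_orth, folded r_def zO_def]
  have b3_deriv: "((\<lambda>s. b - bh3 (x s)) has_vector_derivative - dbh3 P pd t (x t)) (at t within {0..})"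
    by (rule has_vector_derivative_eq_rhs, (rule deriv_rules bh_deriv t)+) simp
  have adj: "- dbh3 P pd t (x t) \<bullet> (L3 *v \<beta>) = hOm P * (zO \<bullet> (Theta P pd t (x t) *v \<beta>))"
  proof -
    have "- dbh3 P pd t (x t) \<bullet> (L3 *v \<beta>)
        = hOm P * ((Lam3 P *v (transpose (Theta P pd t (x t)) *v zO)) \<bullet> (L3 *v \<beta>))"
      by (simp add: dbh3_def zO_def)
    also have "\<dots> = hOm P * ((transpose (Theta P pd t (x t)) *v zO) \<bullet> \<beta>)"
      using inner_mat_vec_commute[OF L_sym(3), of _ \<beta>] by (metis L_inv(3))
    also have "\<dots> = hOm P * (zO \<bullet> (Theta P pd t (x t) *v \<beta>))"
      by (simp add: dot_lmul_matrix)
    finally show ?thesis .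
  qed
  have Theta: "Theta P pd t (x t) *v \<beta> = D' - D"
    using dOm12c_bar_diff[of P pd t "x t" b]
    by (simp add: \<beta>_def D_def D'_def mat_vec_simps algebra_simps)
  have zO_deriv: "((\<lambda>s. z_Om P pd s (x s)) has_vector_derivative
      - ((1 / jperp P) *\<^sub>R (r \<times> (r \<times> \<Gamma>))) - D') (at t within {0..})"
    unfolding z_Om_def r_def \<Gamma>_def D'_def by (intro has_vector_derivative_diff Om12_closed_loop_deriv Om12c_deriv t)
  have \<Gamma>: "zO \<bullet> \<Gamma> = - jperp P * ((kOm P / hOm P) * (zO \<bullet> zO) + (hr P / hOm P) * (zO \<bullet> zr) - zO \<bullet> D)"
    by (simp add: \<Gamma>_def Gam_c_def skew2_mult_vec inner_add_right zO_def[symmetric] zr_def[symmetric]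
        r_def[symmetric] D_def[symmetric] orth)
  have "(lyap_rate has_vector_derivative
      hOm P * ((- ((1 / jperp P) *\<^sub>R (r \<times> (r \<times> \<Gamma>))) - D') \<bullet> (mat 1 *v zO)) + - dbh3 P pd t (x t) \<bullet> (L3 *v \<beta>))
      (at t within {0..})"
    unfolding lyap_rate_def[abs_def] zO_def \<beta>_def
    by (intro has_vector_derivative_add has_vector_derivative_mult_right
        has_vector_derivative_quadratic transpose_mat L_sym b3_deriv zO_deriv t)
  also have "hOm P * ((- ((1 / jperp P) *\<^sub>R (r \<times> (r \<times> \<Gamma>))) - D') \<bullet> (mat 1 *v zO)) + - dbh3 P pd t (x t) \<bullet> (L3 *v \<beta>)
     = hOm P * ((1 / jperp P) * (zO \<bullet> \<Gamma>) - zO \<bullet> D')  + hOm P * (zO \<bullet> (D' - D))"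
    unfolding adj Theta
    by (subst inner_commute) (simp add: inner_diff_right orth)
  also have "\<dots> = - (hr P * (zr \<bullet> zO)) - kOm P * (norm zO)\<^sup>2"
    unfolding \<Gamma> power2_norm_eq_inner using positive
    by (simp add: inner_diff_right inner_commute[of zr] field_simps)
  finally show ?thesis by (simp add: zr_def zO_def)
qed

definition lyap :: "real \<Rightarrow> real" where
  "lyap t = lyap_pos t + lyap_dir t + lyap_rate t"

lemma lyap_deriv:
  assumes t: "0 \<le> t"
  shows "(lyap has_vector_derivative - lyap_diss t) (at t within {0..})"
  unfolding lyap_def[abs_def]
  by (rule has_vector_derivative_eq_rhs,
      (rule has_vector_derivative_add lyap_pos_deriv lyap_dir_deriv lyap_rate_deriv t)+)
    (simp add: lyap_diss_def)

text \<open>All summands are nonnegative, the alignment term by Cauchy-Schwarz for two unit vectors,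
  so each is dominated by the sum.\<close>

lemma lyap_lower_bounds:
  assumes t: "0 \<le> t"
  shows "1/2 * (norm (z1 P pd t (x t)))\<^sup>2 \<le> lyap t" "1/2 * (norm (err P pd t (x t)))\<^sup>2 \<le> lyap t"
    "1/2 * ((b - bh1 (x t)) \<bullet> (L1 *v (b - bh1 (x t)))) \<le> lyap t"
    "1/2 * ((b - bh2 (x t)) \<bullet> (L2 *v (b - bh2 (x t)))) \<le> lyap t"
    "hOm P / 2 * (norm (z_Om P pd t (x t)))\<^sup>2 \<le> lyap t"
    "1/2 * ((b - bh3 (x t)) \<bullet> (L3 *v (b - bh3 (x t)))) \<le> lyap t"
proof -
  have q: "0 \<le> v \<bullet> (L1 *v v)" "0 \<le> v \<bullet> (L2 *v v)" "0 \<le> v \<bullet> (L3 *v v)" for v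
    using L unfolding pos_def_matrix_def by (cases "v = 0"; force)+
  have "r3 (x t) \<bullet> r3d P pd t (x t) \<le> 1"
    using Cauchy_Schwarz_ineq2[of "r3 (x t)" "r3d P pd t (x t)"] unit_r3[OF t] unit_r3d[OF t] by simp
  then have "0 \<le> hr P * (1 - r3 (x t) \<bullet> r3d P pd t (x t))"
    using positive by simp
  moreover have "0 \<le> hOm P / 2 * (norm (z_Om P pd t (x t)))\<^sup>2"
    using positive by simp
  moreover have "lyap t = 1/2 * (norm (z1 P pd t (x t)))\<^sup>2 + 1/2 * (norm (err P pd t (x t)))\<^sup>2
     + 1/2 * ((b - bh1 (x t)) \<bullet> (L1 *v (b - bh1 (x t))))
     + hr P * (1 - r3 (x t) \<bullet> r3d P pd t (x t))
     + 1/2 * ((b - bh2 (x t)) \<bullet> (L2 *v (b - bh2 (x t))))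
     + hOm P / 2 * (norm (z_Om P pd t (x t)))\<^sup>2
     + 1/2 * ((b - bh3 (x t)) \<bullet> (L3 *v (b - bh3 (x t))))"
    by (simp add: lyap_def lyap_pos_def lyap_dir_def lyap_rate_def power2_norm_eq_inner)
  ultimately show "1/2 * (norm (z1 P pd t (x t)))\<^sup>2 \<le> lyap t" "1/2 * (norm (err P pd t (x t)))\<^sup>2 \<le> lyap t"
    "1/2 * ((b - bh1 (x t)) \<bullet> (L1 *v (b - bh1 (x t)))) \<le> lyap t"
    "1/2 * ((b - bh2 (x t)) \<bullet> (L2 *v (b - bh2 (x t)))) \<le> lyap t"
    "hOm P / 2 * (norm (z_Om P pd t (x t)))\<^sup>2 \<le> lyap t"
    "1/2 * ((b - bh3 (x t)) \<bullet> (L3 *v (b - bh3 (x t)))) \<le> lyap t"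
    using q[of "b - bh1 (x t)"] q[of "b - bh2 (x t)"] q[of "b - bh3 (x t)"]
      zero_le_power2[of "norm (z1 P pd t (x t))"] zero_le_power2[of "norm (err P pd t (x t))"]
    by linarith+
qed

end

end

section \<open>Boundedness and convergence\<close>

lemma bounded_signal_linear:
  assumes "bounded_linear h" "bounded_signal f"
  shows "bounded_signal (\<lambda>t. h (f t))"
  using bounded_linear_image[OF _ assms(1), of "f ` {0..}"] assms(2)
  by (simp add: bounded_signal_def image_image)

lemma bounded_signal_transpose [bounded_intros]:
  "bounded_signal A \<Longrightarrow> bounded_signal (\<lambda>t. transpose (A t))" for A :: "real \<Rightarrow> real^'n^'m"
proof (rule bounded_signal_linear[of transpose])
  have "linear (transpose :: real^'n^'m \<Rightarrow> _)"
    by (simp add: linear_iff transpose_def vec_eq_iff)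
  then show "bounded_linear (transpose :: real^'n^'m \<Rightarrow> _)"
    by (simp add: linear_conv_bounded_linear)
qed

lemma bounded_signal_skew [bounded_intros]: "bounded_signal f \<Longrightarrow> bounded_signal (\<lambda>t. skew (f t))"
proof (rule bounded_signal_linear[of skew])
  have "linear skew"
    by (auto simp: linear_iff matrix_eq skew_mult_vec mat_vec_simps cross_add_left cross_mult_left)
  then show "bounded_linear skew"
    by (simp add: linear_conv_bounded_linear)
qed

lemma bounded_signal_matrix_mult [bounded_intros]:
  fixes A :: "real \<Rightarrow> real^'n^'m" and B :: "real \<Rightarrow> real^'k^'n"
  assumes "bounded_signal A" "bounded_signal B"
  shows "bounded_signal (\<lambda>t. A t ** B t)"
proof -
  have "bilinear ((**) :: real^'n^'m \<Rightarrow> real^'k^'n \<Rightarrow> _)"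
    by (auto simp: bilinear_def linear_iff matrix_eq mat_vec_simps simp flip: matrix_vector_mul_assoc)
  then have "bounded_bilinear ((**) :: real^'n^'m \<Rightarrow> real^'k^'n \<Rightarrow> _)"
    by (simp add: bilinear_conv_bounded_bilinear)
  then show ?thesis
    using assms by (rule bounded_signal_bilinear)
qed

lemma norm_cross_le: "norm (v \<times> w) \<le> norm v * norm w"
proof (rule power2_le_imp_le)
  show "(norm (v \<times> w))\<^sup>2 \<le> (norm v * norm w)\<^sup>2"
    by (simp add: norm_cross power_mult_distrib)
qed simp

context tracking_loop
begin

section \<open>Dissipation and the bounds it implies\<close>

lemma lyap_diss_lower:
  "z1 P pd t (x t) \<bullet> (Kp P *v z1 P pd t (x t)) \<le> lyap_diss t"
  "err P pd t (x t) \<bullet> (Kv P *v err P pd t (x t)) \<le> lyap_diss t"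
  "kr P * (norm (z_r P pd t (x t)))\<^sup>2 \<le> lyap_diss t"
  "kOm P * (norm (z_Om P pd t (x t)))\<^sup>2 \<le> lyap_diss t"
  and lyap_diss_nonneg: "0 \<le> lyap_diss t"
proof -
  have "pos_def_matrix (Kp P)" "pos_def_matrix (Kv P)"
    using params by (simp_all add: valid_params_def)
  then have "0 \<le> v \<bullet> (Kp P *v v)" "0 \<le> v \<bullet> (Kv P *v v)" for v
    unfolding pos_def_matrix_def by (cases "v = 0"; force)+
  then have "0 \<le> z1 P pd t (x t) \<bullet> (Kp P *v z1 P pd t (x t))" "0 \<le> err P pd t (x t) \<bullet> (Kv P *v err P pd t (x t))"
    by blast+
  moreover have "0 \<le> kr P * (norm (z_r P pd t (x t)))\<^sup>2" "0 \<le> kOm P * (norm (z_Om P pd t (x t)))\<^sup>2"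
    using positive by simp_all
  ultimately show "z1 P pd t (x t) \<bullet> (Kp P *v z1 P pd t (x t)) \<le> lyap_diss t"
    "err P pd t (x t) \<bullet> (Kv P *v err P pd t (x t)) \<le> lyap_diss t"
    "kr P * (norm (z_r P pd t (x t)))\<^sup>2 \<le> lyap_diss t"
    "kOm P * (norm (z_Om P pd t (x t)))\<^sup>2 \<le> lyap_diss t"
    "0 \<le> lyap_diss t"
    unfolding lyap_diss_def by linarith+
qed

text \<open>Hides the inverse gains: what follows uses only the derivative of \<open>V\<close> and
  these lower bounds, with one constant \<open>cb\<close> for all three estimates.\<close>

lemma lyapunov_function: "\<exists>V cb. cb > 0 \<and> (\<forall>t\<ge>0.
    (V has_vector_derivative - lyap_diss t) (at t within {0..}) \<and>
    1/2 * (norm (z1 P pd t (x t)))\<^sup>2 \<le> V t \<and> 1/2 * (norm (err P pd t (x t)))\<^sup>2 \<le> V t \<and>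
    hOm P / 2 * (norm (z_Om P pd t (x t)))\<^sup>2 \<le> V t \<and>
    cb * (norm (b - bh1 (x t)))\<^sup>2 \<le> V t \<and> cb * (norm (b - bh2 (x t)))\<^sup>2 \<le> V t \<and>
    cb * (norm (b - bh3 (x t)))\<^sup>2 \<le> V t)"
proof -
  have pd: "pos_def_matrix (Lam1 P)" "pos_def_matrix (Lam2 P)" "pos_def_matrix (Lam3 P)"
    using params by (simp_all add: valid_params_def)
  obtain L1 where L1: "pos_def_matrix L1" "\<And>v. L1 *v (Lam1 P *v v) = v"
    using pos_def_matrix_inverse[OF pd(1)] by blast
  obtain L2 where L2: "pos_def_matrix L2" "\<And>v. L2 *v (Lam2 P *v v) = v"
    using pos_def_matrix_inverse[OF pd(2)] by blast
  obtain L3 where L3: "pos_def_matrix L3" "\<And>v. L3 *v (Lam3 P *v v) = v"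
    using pos_def_matrix_inverse[OF pd(3)] by blast
  note L = L1(1) L2(1) L3(1) L1(2) L2(2) L3(2)
  obtain c1 where c1: "c1 > 0" "\<And>v. c1 * (norm v)\<^sup>2 \<le> v \<bullet> (L1 *v v)"
    using pos_def_matrix_coercive[OF L(1)] by blast
  obtain c2 where c2: "c2 > 0" "\<And>v. c2 * (norm v)\<^sup>2 \<le> v \<bullet> (L2 *v v)"
    using pos_def_matrix_coercive[OF L(2)] by blast
  obtain c3 where c3: "c3 > 0" "\<And>v. c3 * (norm v)\<^sup>2 \<le> v \<bullet> (L3 *v v)"
    using pos_def_matrix_coercive[OF L(3)] by blast
  define cb where "cb = 1/2 * min c1 (min c2 c3)"
  have cb: "cb * (norm v)\<^sup>2 \<le> 1/2 * (v \<bullet> (L1 *v v))" "cb * (norm v)\<^sup>2 \<le> 1/2 * (v \<bullet> (L2 *v v))"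
    "cb * (norm v)\<^sup>2 \<le> 1/2 * (v \<bullet> (L3 *v v))" for v :: "real^3"
  proof -
    have "cb * (norm v)\<^sup>2 \<le> 1/2 * c1 * (norm v)\<^sup>2" "cb * (norm v)\<^sup>2 \<le> 1/2 * c2 * (norm v)\<^sup>2"
      "cb * (norm v)\<^sup>2 \<le> 1/2 * c3 * (norm v)\<^sup>2"
      by (rule mult_right_mono; simp add: cb_def)+
    then show "cb * (norm v)\<^sup>2 \<le> 1/2 * (v \<bullet> (L1 *v v))" "cb * (norm v)\<^sup>2 \<le> 1/2 * (v \<bullet> (L2 *v v))"
      "cb * (norm v)\<^sup>2 \<le> 1/2 * (v \<bullet> (L3 *v v))"
      using c1(2)[of v] c2(2)[of v] c3(2)[of v] by linarith+
  qed
  have "cb > 0" using c1 c2 c3 by (simp add: cb_def)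
  moreover note bounds = lyap_lower_bounds[OF L] lyap_deriv[OF L]
  ultimately show ?thesis
    by (intro exI[of _ "lyap L1 L2 L3"] exI[of _ cb] conjI allI impI bounds
        order_trans[OF cb(1) bounds(3)] order_trans[OF cb(2) bounds(4)] order_trans[OF cb(3) bounds(6)])
qed

text \<open>\<open>V\<close> does not increase, so its initial value bounds every error that it
  dominates.\<close>

lemma basic_bounds:
  "bounded_signal (\<lambda>t. z1 P pd t (x t))" "bounded_signal (\<lambda>t. err P pd t (x t))"
  "bounded_signal (\<lambda>t. z_Om P pd t (x t))" "bounded_signal (\<lambda>t. bh1 (x t))"
  "bounded_signal (\<lambda>t. bh2 (x t))" "bounded_signal (\<lambda>t. bh3 (x t))"
proof -
  obtain V cb where cb: "cb > 0" and V: "\<And>t. t \<ge> 0 \<Longrightarrow>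
    (V has_vector_derivative - lyap_diss t) (at t within {0..}) \<and>
    1/2 * (norm (z1 P pd t (x t)))\<^sup>2 \<le> V t \<and> 1/2 * (norm (err P pd t (x t)))\<^sup>2 \<le> V t \<and>
    hOm P / 2 * (norm (z_Om P pd t (x t)))\<^sup>2 \<le> V t \<and>
    cb * (norm (b - bh1 (x t)))\<^sup>2 \<le> V t \<and> cb * (norm (b - bh2 (x t)))\<^sup>2 \<le> V t \<and>
    cb * (norm (b - bh3 (x t)))\<^sup>2 \<le> V t"
    using lyapunov_function by blast
  have V0: "V t \<le> V 0" if "t \<ge> 0" for t
    using lyapunov_decrease[of V "\<lambda>t. - lyap_diss t" lyap_diss 0 t 0] V lyap_diss_nonneg that
    by auto
  have bnd: "bounded_signal f" if "c > 0" "\<And>t. t \<ge> 0 \<Longrightarrow> c * (norm (f t))\<^sup>2 \<le> V t"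
    for f :: "real \<Rightarrow> real^3" and c
    using that(1) by (rule bounded_signal_of_sq) (rule order_trans[OF that(2) V0])
  show "bounded_signal (\<lambda>t. z1 P pd t (x t))" "bounded_signal (\<lambda>t. err P pd t (x t))"
    by (rule bnd[of "1/2"], simp, use V in blast)+
  show "bounded_signal (\<lambda>t. z_Om P pd t (x t))"
    by (rule bnd[of "hOm P / 2"], simp add: positive, use V in blast)
  have "bounded_signal (\<lambda>t. b - bh1 (x t))" "bounded_signal (\<lambda>t. b - bh2 (x t))"
    "bounded_signal (\<lambda>t. b - bh3 (x t))"
    by (rule bnd[OF cb], use V in blast)+
  from this[THEN bounded_signal_diff[OF bounded_signal_const[of b]]]
  show "bounded_signal (\<lambda>t. bh1 (x t))" "bounded_signal (\<lambda>t. bh2 (x t))" "bounded_signal (\<lambda>t. bh3 (x t))"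
    by simp_all
qed

text \<open>Reduces each convergence claim to domination by the dissipation and boundedness of one
  derivative.\<close>

lemma tendsto_zero_of_dissipation:
  fixes f :: "real \<Rightarrow> real^3"
  assumes "c > 0" "\<And>t. t \<ge> 0 \<Longrightarrow> c * (norm (f t))\<^sup>2 \<le> lyap_diss t"
    and "\<And>t. t \<ge> 0 \<Longrightarrow> (f has_vector_derivative f' t) (at t within {0..})" "bounded_signal f'"
  shows "(f \<longlongrightarrow> 0) at_top"
proof -
  obtain V where V:
    "\<And>t. t \<ge> 0 \<Longrightarrow> (V has_vector_derivative - lyap_diss t) (at t within {0..}) \<and>
      1/2 * (norm (z1 P pd t (x t)))\<^sup>2 \<le> V t"
    using lyapunov_function by blast
  have "0 \<le> V t" if "t \<ge> 0" for t
    using V[OF that] zero_le_power2[of "norm (z1 P pd t (x t))"] by linarith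
  with V have V: "\<And>t. t \<ge> 0 \<Longrightarrow> (V has_vector_derivative - lyap_diss t) (at t within {0..})"
    "\<And>t. t \<ge> 0 \<Longrightarrow> 0 \<le> V t"
    by blast+
  from barbalat_lyapunov[OF V assms(1) _ assms(3,4)] assms(2) show ?thesis by auto
qed

lemma ref_bounds:
  "bounded_signal (tderiv 1 pd)" "bounded_signal (tderiv 2 pd)" "bounded_signal (tderiv 3 pd)"
  "bounded_signal (tderiv 4 pd)"
  using ref_bounded by simp_all

lemma unit_bounds: "bounded_signal (\<lambda>t. r3 (x t))" "bounded_signal (\<lambda>t. r3d P pd t (x t))"
  using unit_r3 unit_r3d by (auto simp: bounded_signal_iff intro!: exI[of _ 1])

text \<open>Apart from the unit vector \<open>r3d\<close>, none of these quantities divides by the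
  norm of \<open>xi\<close>, so the Lyapunov bounds propagate along the definitions.\<close>

lemma translational_bounds:
  "bounded_signal (\<lambda>t. z2 P pd t (x t))" "bounded_signal (\<lambda>t. v_del P (x t))"
  "bounded_signal (\<lambda>t. xi P pd t (x t))" "bounded_signal (\<lambda>t. u3_bar P pd t (x t))"
  "bounded_signal (\<lambda>t. z_r P pd t (x t))" "bounded_signal (\<lambda>t. dxi_hat P pd t (x t))"
  "bounded_signal (\<lambda>t. dz2_hat P pd t (x t))"
proof -
  have "bounded_signal (\<lambda>t. err P pd t (x t) - Kp P *v z1 P pd t (x t))"
    by (intro bounded_intros basic_bounds)
  then show z2: "bounded_signal (\<lambda>t. z2 P pd t (x t))" by (simp add: err_def)
  have "bounded_signal (\<lambda>t. z2 P pd t (x t) + tderiv 1 pd t)"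
    by (intro bounded_intros z2 ref_bounds)
  then show "bounded_signal (\<lambda>t. v_del P (x t))" by (simp add: z2_def)
  show xi: "bounded_signal (\<lambda>t. xi P pd t (x t))"
    unfolding xi_def zeta_def by (intro bounded_intros basic_bounds z2 ref_bounds)
  show u3: "bounded_signal (\<lambda>t. u3_bar P pd t (x t))"
    unfolding u3_bar_def by (intro bounded_intros xi unit_bounds)
  show "bounded_signal (\<lambda>t. z_r P pd t (x t))"
    unfolding z_r_def skew_mult_vec by (intro bounded_intros unit_bounds)
  show dz2: "bounded_signal (\<lambda>t. dz2_hat P pd t (x t))"
    unfolding dz2_hat_def by (intro bounded_intros basic_bounds unit_bounds u3 ref_bounds)
  show "bounded_signal (\<lambda>t. dxi_hat P pd t (x t))"
    unfolding dxi_hat_def dzeta_hat_def dbh1_def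
    by (intro bounded_intros basic_bounds z2 dz2 ref_bounds)
qed

text \<open>The signal \<beta> is arbitrary because two cases occur: the constant \<open>b\<close>,
  giving true derivatives, and \<open>bh3\<close>, giving the quantities computed by the
  controller.\<close>

lemma bar_bounds:
  assumes "bounded_signal \<beta>"
  shows "bounded_signal (\<lambda>t. dz2_bar P pd t ((x t)\<lparr>bh3 := \<beta> t\<rparr>))"
    "bounded_signal (\<lambda>t. derr_bar P pd t ((x t)\<lparr>bh3 := \<beta> t\<rparr>))"
    "bounded_signal (\<lambda>t. dxi_bar P pd t ((x t)\<lparr>bh3 := \<beta> t\<rparr>))"
proof -
  show dz2: "bounded_signal (\<lambda>t. dz2_bar P pd t ((x t)\<lparr>bh3 := \<beta> t\<rparr>))"
    unfolding dz2_bar_def bh3_indep using assms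
    by (simp, intro bounded_intros translational_bounds basic_bounds)
  show "bounded_signal (\<lambda>t. derr_bar P pd t ((x t)\<lparr>bh3 := \<beta> t\<rparr>))"
    unfolding derr_bar_def bh3_indep
    by (intro bounded_intros translational_bounds dz2)
  show "bounded_signal (\<lambda>t. dxi_bar P pd t ((x t)\<lparr>bh3 := \<beta> t\<rparr>))"
    unfolding dxi_bar_def dzeta_bar_def dbh1_def bh3_indep
    by (intro bounded_intros translational_bounds dz2 basic_bounds ref_bounds)
qed

section \<open>Convergence without a lower bound on the norm of \<open>xi\<close>\<close>

lemma tracking_convergence:
  "((\<lambda>t. z1 P pd t (x t)) \<longlongrightarrow> 0) at_top" "((\<lambda>t. err P pd t (x t)) \<longlongrightarrow> 0) at_top"
  "((\<lambda>t. z2 P pd t (x t)) \<longlongrightarrow> 0) at_top"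
proof -
  have pd: "pos_def_matrix (Kp P)" "pos_def_matrix (Kv P)"
    using params by (simp_all add: valid_params_def)
  obtain c where c: "c > 0" "\<And>v. c * (norm v)\<^sup>2 \<le> v \<bullet> (Kp P *v v)"
    using pos_def_matrix_coercive[OF pd(1)] by blast
  obtain d where d: "d > 0" "\<And>v. d * (norm v)\<^sup>2 \<le> v \<bullet> (Kv P *v v)"
    using pos_def_matrix_coercive[OF pd(2)] by blast
  show z1: "((\<lambda>t. z1 P pd t (x t)) \<longlongrightarrow> 0) at_top"
    using order_trans[OF c(2) lyap_diss_lower(1)]
    by (intro tendsto_zero_of_dissipation[OF c(1) _ z1_deriv]) (auto intro: translational_bounds)
  show e: "((\<lambda>t. err P pd t (x t)) \<longlongrightarrow> 0) at_top"
    using order_trans[OF d(2) lyap_diss_lower(2)]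
    by (intro tendsto_zero_of_dissipation[OF d(1) _ err_deriv])
      (auto intro: bar_bounds[OF bounded_signal_const])
  have "((\<lambda>t. err P pd t (x t) - Kp P *v z1 P pd t (x t)) \<longlongrightarrow> 0 - Kp P *v 0) at_top"
    by (intro tendsto_diff e bounded_linear.tendsto[OF matrix_vector_mul_bounded_linear] z1)
  then show "((\<lambda>t. z2 P pd t (x t)) \<longlongrightarrow> 0) at_top"
    by (simp add: err_def)
qed

text \<open>The factor \<open>\<parallel>xi\<parallel>\<close> compensates the only division by \<open>\<parallel>xi\<parallel>\<close> in the commanded angular velocity, so
  no lower bound on \<open>\<parallel>xi\<parallel>\<close> is needed.\<close>

lemma norm_xi_Om12_bounded: "bounded_signal (\<lambda>t. norm (xi P pd t (x t)) *\<^sub>R Om12 (x t))"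
proof -
  define n where "n t = norm (xi P pd t (x t))" for t
  have n: "bounded_signal n"
    unfolding n_def[abs_def] by (intro bounded_intros translational_bounds)
  have hat: "n t *\<^sub>R Om12d_hat P pd t (x t)
      = r3d P pd t (x t) \<times> - (r3d P pd t (x t) \<times> (r3d P pd t (x t) \<times> dxi_hat P pd t (x t)))"
    if "t \<ge> 0" for t
    using xi_nonzero[OF that]
    by (simp add: Om12d_hat_def dr3d_hat_def skew_mult_vec skew2_mult_vec cross_mult_right n_def)
  have "bounded_signal (\<lambda>t. r3d P pd t (x t) \<times> - (r3d P pd t (x t) \<times> (r3d P pd t (x t) \<times> dxi_hat P pd t (x t))))"
    by (intro bounded_intros unit_bounds translational_bounds)
  then have nO: "bounded_signal (\<lambda>t. n t *\<^sub>R Om12d_hat P pd t (x t))"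
    by (rule bounded_signal_cong) (rule hat)
  have "bounded_signal (\<lambda>t. n t *\<^sub>R z_Om P pd t (x t) + - ((kr P / hr P) *\<^sub>R (n t *\<^sub>R z_r P pd t (x t)))
      + (1 / hr P) *\<^sub>R (n t *\<^sub>R (n t *\<^sub>R (r3 (x t) \<times> err P pd t (x t))))
      - r3 (x t) \<times> (r3 (x t) \<times> (n t *\<^sub>R Om12d_hat P pd t (x t))))"
    by (rule nO bounded_intros unit_bounds translational_bounds basic_bounds n)+
  also have "(\<lambda>t. n t *\<^sub>R z_Om P pd t (x t) + - ((kr P / hr P) *\<^sub>R (n t *\<^sub>R z_r P pd t (x t)))
      + (1 / hr P) *\<^sub>R (n t *\<^sub>R (n t *\<^sub>R (r3 (x t) \<times> err P pd t (x t))))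
      - r3 (x t) \<times> (r3 (x t) \<times> (n t *\<^sub>R Om12d_hat P pd t (x t)))) = (\<lambda>t. n t *\<^sub>R Om12 (x t))"
    by (simp add: z_Om_def Om12c_def skew_mult_vec skew2_mult_vec cross_mult_right scaleR_add_right
        scaleR_diff_right n_def[symmetric] mult.commute)
  finally show ?thesis by (simp add: n_def)
qed

text \<open>This vector is \<open>z_r\<close> scaled by the norm of \<open>xi\<close>. Boundedness
  of \<open>xi\<close> keeps it dominated by the dissipation, whence the factor
  \<open>kr P / B\<^sup>2\<close>, and in its derivative the same scaling turns \<open>Om12\<close>
  into the bounded signal of \<open>norm_xi_Om12_bounded\<close>.\<close>

lemma xi_cross_r3_tendsto: "((\<lambda>t. xi P pd t (x t) \<times> r3 (x t)) \<longlongrightarrow> 0) at_top"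
proof -
  obtain B where B: "B > 0" "\<And>t. t \<ge> 0 \<Longrightarrow> norm (xi P pd t (x t)) \<le> B"
    using bounded_signalE[OF translational_bounds(3)] by metis
  have D: "((\<lambda>t. xi P pd t (x t) \<times> r3 (x t)) has_vector_derivative
     (xi P pd t (x t) \<times> dr3 (x t) + dxi_bar P pd t (xb t) \<times> r3 (x t))) (at t within {0..})"
    if "t \<ge> 0" for t
    by (intro has_vector_derivative_cross xi_deriv r3_deriv that)
  have "bounded_signal (\<lambda>t. r3d P pd t (x t) \<times> - (r3 (x t) \<times> (norm (xi P pd t (x t)) *\<^sub>R Om12 (x t)))
     + dxi_bar P pd t (xb t) \<times> r3 (x t))"
    by (rule norm_xi_Om12_bounded bounded_intros unit_bounds bar_bounds)+
  moreover have "xi P pd t (x t) \<times> dr3 (x t) + dxi_bar P pd t (xb t) \<times> r3 (x t)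
     = r3d P pd t (x t) \<times> - (r3 (x t) \<times> (norm (xi P pd t (x t)) *\<^sub>R Om12 (x t)))
     + dxi_bar P pd t (xb t) \<times> r3 (x t)"
    if "t \<ge> 0" for t
    using xi_nonzero[OF that]
    by (simp add: r3d_def dr3_def skew_mult_vec cross_mult_left cross_mult_right)
  ultimately have D': "bounded_signal (\<lambda>t. xi P pd t (x t) \<times> dr3 (x t) + dxi_bar P pd t (xb t) \<times> r3 (x t))"
    by (rule bounded_signal_cong)
  have "kr P / B\<^sup>2 * (norm (xi P pd t (x t) \<times> r3 (x t)))\<^sup>2 \<le> lyap_diss t" if t: "t \<ge> 0" for t
  proof -
    have "xi P pd t (x t) \<times> r3 (x t) = norm (xi P pd t (x t)) *\<^sub>R z_r P pd t (x t)"
      by (subst xi_eq[OF t]) (simp add: z_r_def skew_mult_vec cross_mult_left)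
    then have "norm (xi P pd t (x t) \<times> r3 (x t)) \<le> B * norm (z_r P pd t (x t))"
      using B(2)[OF t] by (simp add: mult_right_mono)
    then have "(norm (xi P pd t (x t) \<times> r3 (x t)))\<^sup>2 \<le> B\<^sup>2 * (norm (z_r P pd t (x t)))\<^sup>2"
      by (metis norm_ge_zero power_mono power_mult_distrib)
    then have "kr P / B\<^sup>2 * (norm (xi P pd t (x t) \<times> r3 (x t)))\<^sup>2 \<le> kr P / B\<^sup>2 * (B\<^sup>2 * (norm (z_r P pd t (x t)))\<^sup>2)"
      using positive by (intro mult_left_mono) auto
    also have "\<dots> = kr P * (norm (z_r P pd t (x t)))\<^sup>2" using B(1) by simp
    also have "\<dots> \<le> lyap_diss t" by (rule lyap_diss_lower)
    finally show ?thesis .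
  qed
  moreover have "kr P / B\<^sup>2 > 0" using positive B by simp
  ultimately show ?thesis
    using D D' by (intro tendsto_zero_of_dissipation)
qed

text \<open>In \<open>derr_bar_eq\<close> everything besides \<open>b - bh1\<close> vanishes in the
  limit, since the thrust deficit is no longer than \<open>xi \<times> r3\<close>. The first
  adaptation law makes \<open>bh1\<close> slowly varying once \<open>err\<close> is small.\<close>

lemma estimate_convergence: "((\<lambda>t. bh1 (x t)) \<longlongrightarrow> b) at_top"
proof -
  let ?r = "\<lambda>t. - z1 P pd t (x t) - Kv P *v err P pd t (x t) - r3 (x t) \<times> (r3 (x t) \<times> xi P pd t (x t))"
  note mv = bounded_linear.tendsto[OF matrix_vector_mul_bounded_linear]
  have "((\<lambda>t. r3 (x t) \<times> (r3 (x t) \<times> xi P pd t (x t))) \<longlongrightarrow> 0) at_top"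
  proof (rule Lim_null_comparison)
    show "((\<lambda>t. norm (xi P pd t (x t) \<times> r3 (x t))) \<longlongrightarrow> 0) at_top"
      using tendsto_norm_zero[OF xi_cross_r3_tendsto] .
    show "\<forall>\<^sub>F t in at_top. norm (r3 (x t) \<times> (r3 (x t) \<times> xi P pd t (x t))) \<le> norm (xi P pd t (x t) \<times> r3 (x t))"
      using eventually_ge_at_top[of 0]
    proof eventually_elim
      case (elim t)
      show ?case
        using norm_cross_le[of "r3 (x t)" "r3 (x t) \<times> xi P pd t (x t)"] unit_r3[OF elim]
        by (simp add: cross_skew[of "xi P pd t (x t)"])
    qed
  qed
  then have "(?r \<longlongrightarrow> - 0 - Kv P *v 0 - 0) at_top"
    by (intro tendsto_diff tendsto_minus mv tracking_convergence)
  then have r: "(?r \<longlongrightarrow> 0) at_top" by simp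
  have "((\<lambda>t. - (Lam1 P *v err P pd t (x t))) \<longlongrightarrow> - (Lam1 P *v 0)) at_top"
    by (intro tendsto_minus mv tracking_convergence)
  then have g': "((\<lambda>t. - (Lam1 P *v err P pd t (x t))) \<longlongrightarrow> 0) at_top" by simp
  have De: "((\<lambda>s. err P pd s (x s)) has_vector_derivative ((b - bh1 (x t)) + ?r t)) (at t within {0..})"
    if "t \<ge> 0" for t
    using err_deriv[OF that] unfolding derr_bar_eq[OF that] by (simp add: algebra_simps)
  have Db: "((\<lambda>s. b - bh1 (x s)) has_vector_derivative - (Lam1 P *v err P pd t (x t))) (at t within {0..})"
    if "t \<ge> 0" for t
    by (rule has_vector_derivative_eq_rhs, (rule deriv_rules bh_deriv that)+) (simp add: dbh1_def)
  have "((\<lambda>t. b - bh1 (x t)) \<longlongrightarrow> 0) at_top"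
    by (rule tendsto_zero_of_derivative_split[OF De Db tracking_convergence(2) r g'])
  from tendsto_diff[OF tendsto_const[of b] this] show ?thesis by simp
qed

section \<open>Attitude loop with \<open>xi\<close> bounded away from zero\<close>

context
  assumes uniform: "xi_uniformly_nonzero P pd x"
begin

lemma inverse_norm_xi_bounded: "bounded_signal (\<lambda>t. 1 / norm (xi P pd t (x t)))"
proof -
  obtain c where "c > 0" "\<And>t. t \<ge> 0 \<Longrightarrow> c \<le> norm (xi P pd t (x t))"
    using uniform by (auto simp: xi_uniformly_nonzero_def)
  then show ?thesis
    by (auto simp: bounded_signal_iff intro!: exI[of _ "1 / c"] divide_left_mono)
       (metis less_le_trans mult_pos_pos zero_less_norm_iff)
qed

lemma attitude_bounds:
  "bounded_signal (\<lambda>t. dr3d_hat P pd t (x t))" "bounded_signal (\<lambda>t. Om12d_hat P pd t (x t))"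
  "bounded_signal (\<lambda>t. Om12c P pd t (x t))" "bounded_signal (\<lambda>t. Om12 (x t))"
  "bounded_signal (\<lambda>t. dr3 (x t))" "bounded_signal (\<lambda>t. dbh2 P pd t (x t))"
proof -
  show d: "bounded_signal (\<lambda>t. dr3d_hat P pd t (x t))"
    unfolding dr3d_hat_def skew2_mult_vec
    by (intro bounded_intros unit_bounds translational_bounds inverse_norm_xi_bounded)
  show Od: "bounded_signal (\<lambda>t. Om12d_hat P pd t (x t))"
    unfolding Om12d_hat_def skew_mult_vec by (intro bounded_intros unit_bounds d)
  show Oc: "bounded_signal (\<lambda>t. Om12c P pd t (x t))"
    unfolding Om12c_def skew_mult_vec skew2_mult_vec
    by (intro bounded_intros unit_bounds translational_bounds basic_bounds Od)
  have "bounded_signal (\<lambda>t. z_Om P pd t (x t) + Om12c P pd t (x t))"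
    by (intro bounded_intros basic_bounds Oc)
  then show O: "bounded_signal (\<lambda>t. Om12 (x t))" by (simp add: z_Om_def)
  show "bounded_signal (\<lambda>t. dr3 (x t))"
    unfolding dr3_def skew_mult_vec by (intro bounded_intros unit_bounds O)
  show "bounded_signal (\<lambda>t. dbh2 P pd t (x t))"
    unfolding dbh2_def Xi_def skew2_def
    by (intro bounded_intros unit_bounds translational_bounds inverse_norm_xi_bounded)
qed

lemma dOm12c_bar_bounded:
  assumes "bounded_signal \<beta>"
  shows "bounded_signal (\<lambda>t. dOm12c_bar P pd t ((x t)\<lparr>bh3 := \<beta> t\<rparr>))"
proof -
  note bnds = unit_bounds translational_bounds basic_bounds ref_bounds attitude_bounds
    bar_bounds[OF assms] inverse_norm_xi_bounded
  have du3: "bounded_signal (\<lambda>t. du3_bar_bar P pd t ((x t)\<lparr>bh3 := \<beta> t\<rparr>))"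
    unfolding du3_bar_bar_def bh3_indep by (intro bounded_intros bnds)
  have ddz2: "bounded_signal (\<lambda>t. ddz2_bar P pd t ((x t)\<lparr>bh3 := \<beta> t\<rparr>))"
    unfolding ddz2_bar_def bh3_indep by (intro bounded_intros bnds du3)
  have ddxi: "bounded_signal (\<lambda>t. ddxi_bar P pd t ((x t)\<lparr>bh3 := \<beta> t\<rparr>))"
    unfolding ddxi_bar_def ddzeta_bar_def bh3_indep by (intro bounded_intros bnds ddz2)
  have dr3d: "bounded_signal (\<lambda>t. dr3d_bar P pd t ((x t)\<lparr>bh3 := \<beta> t\<rparr>))"
    unfolding dr3d_bar_def bh3_indep skew2_mult_vec by (intro bounded_intros bnds)
  have dzr: "bounded_signal (\<lambda>t. dz_r_bar P pd t ((x t)\<lparr>bh3 := \<beta> t\<rparr>))"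
    unfolding dz_r_bar_def bh3_indep skew_mult_vec by (intro bounded_intros bnds dr3d)
  \<comment> \<open>Splits the squared denominator into factors covered by
    \<open>inverse_norm_xi_bounded\<close>.\<close>
  have div: "a / (norm v)\<^sup>2 = a * (1 / norm v) * (1 / norm v)" for a :: real and v :: "real^3"
    by (simp add: power2_eq_square)
  have ddr3d: "bounded_signal (\<lambda>t. ddr3d_bar P pd t ((x t)\<lparr>bh3 := \<beta> t\<rparr>))"
    unfolding ddr3d_bar_def bh3_indep skew2_mult_vec div by (intro bounded_intros bnds dr3d ddxi)
  have dOmd: "bounded_signal (\<lambda>t. dOm12d_bar P pd t ((x t)\<lparr>bh3 := \<beta> t\<rparr>))"
    unfolding dOm12d_bar_def bh3_indep skew_mult_vec by (intro bounded_intros bnds dr3d ddr3d)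
  show ?thesis
    unfolding dOm12c_bar_def bh3_indep skew2_mult_vec by (intro bounded_intros bnds dzr dOmd)
qed

lemma Gam_c_bounded: "bounded_signal (\<lambda>t. Gam_c P pd t (x t))"
proof -
  have "bounded_signal (\<lambda>t. dOm12c_bar P pd t (x t))"
    using dOm12c_bar_bounded[OF basic_bounds(6)] by simp
  then show ?thesis
    unfolding Gam_c_def skew2_mult_vec
    by (intro bounded_intros basic_bounds translational_bounds unit_bounds)
qed

lemma input_bounded: "bounded_signal u"
proof -
  \<comment> \<open>The transposed attitude is again a rotation and preserves the norm of
    \<open>Gam_c\<close>.\<close>
  have "norm (transpose (att (x t)) *v Gam_c P pd t (x t)) = norm (Gam_c P pd t (x t))" if "t \<ge> 0" for t
  proof -
    have "rotation_matrix (transpose (att (x t)))"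
      using rot[OF that] by (simp add: rotation_matrix_def)
    then show ?thesis by (simp only: norm_eq_sqrt_inner rotation_inner)
  qed
  then have RG: "bounded_signal (\<lambda>t. transpose (att (x t)) *v Gam_c P pd t (x t))"
    using Gam_c_bounded by (simp only: bounded_signal_iff) auto
  have "bounded_signal (\<lambda>t. control_law P pd t (x t))"
    unfolding control_law_def skew_mult_vec power2_eq_square
    by (rule RG bounded_intros translational_bounds unit_bounds attitude_bounds)+
  then show ?thesis by (rule bounded_signal_cong) (rule control)
qed

text \<open>\<open>z_r\<close> inherits its limit from \<open>xi \<times> r3\<close> after division
  by the norm of \<open>xi\<close>; \<open>z_Om\<close> is dissipated directly and its derivative is
  bounded by the preceding lemmas.\<close>

lemma attitude_convergence:
  "((\<lambda>t. z_r P pd t (x t)) \<longlongrightarrow> 0) at_top" "((\<lambda>t. z_Om P pd t (x t)) \<longlongrightarrow> 0) at_top"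
proof -
  obtain B where B: "\<And>t. t \<ge> 0 \<Longrightarrow> norm (1 / norm (xi P pd t (x t))) \<le> B"
    using bounded_signalE[OF inverse_norm_xi_bounded] by metis
  show "((\<lambda>t. z_r P pd t (x t)) \<longlongrightarrow> 0) at_top"
  proof (rule Lim_null_comparison)
    show "((\<lambda>t. B * norm (xi P pd t (x t) \<times> r3 (x t))) \<longlongrightarrow> 0) at_top"
      using tendsto_mult[OF tendsto_const tendsto_norm_zero[OF xi_cross_r3_tendsto], of B] by simp
    show "\<forall>\<^sub>F t in at_top. norm (z_r P pd t (x t)) \<le> B * norm (xi P pd t (x t) \<times> r3 (x t))"
      using eventually_ge_at_top[of 0]
    proof eventually_elim
      case (elim t)
      have "norm (z_r P pd t (x t)) = norm (1 / norm (xi P pd t (x t))) * norm (xi P pd t (x t) \<times> r3 (x t))"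
        by (simp add: z_r_def r3d_def skew_mult_vec cross_mult_left)
      also have "\<dots> \<le> B * norm (xi P pd t (x t) \<times> r3 (x t))"
        using B[OF elim] by (intro mult_right_mono) auto
      finally show ?case .
    qed
  qed
  have "((\<lambda>t. z_Om P pd t (x t)) has_vector_derivative
      - ((1 / jperp P) *\<^sub>R (r3 (x t) \<times> (r3 (x t) \<times> Gam_c P pd t (x t)))) - dOm12c_bar P pd t (xb t)) (at t within {0..})"
    if "t \<ge> 0" for t
    unfolding z_Om_def by (intro has_vector_derivative_diff Om12_closed_loop_deriv Om12c_deriv that)
  moreover have "bounded_signal (\<lambda>t. - ((1 / jperp P) *\<^sub>R (r3 (x t) \<times> (r3 (x t) \<times> Gam_c P pd t (x t))))
     - dOm12c_bar P pd t (xb t))"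
    by (intro bounded_intros unit_bounds Gam_c_bounded dOm12c_bar_bounded)
  ultimately show "((\<lambda>t. z_Om P pd t (x t)) \<longlongrightarrow> 0) at_top"
    using positive lyap_diss_lower(4) by (intro tendsto_zero_of_dissipation[of "kOm P"]) auto
qed

end

end

text \<open>Almost global convergence is expressed by nullity of the antipodal set together with
  convergence outside it. The claims whose proofs bound the inverse norm of \<open>xi\<close> are
  conditional on \<open>xi_uniformly_nonzero\<close>.\<close>

theorem theorem1:
  fixes P :: params
    and b :: "real^3"
    and pd :: "real \<Rightarrow> real^3"
    and u :: "real \<Rightarrow> real^3"
    and x :: "real \<Rightarrow> state"
  assumes params: "valid_params P"
    and delta: "delta P = jperp P / (mass P * arm P)"
    and ref_C4: "C_class 4 pd"
    and ref_bounded: "\<And>k. 1 \<le> k \<Longrightarrow> k \<le> 4 \<Longrightarrow> bounded_signal (tderiv k pd)"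
    and plant: "rigid_body_motion P b u x"
    and control: "\<And>t. 0 \<le> t \<Longrightarrow> u t = control_law P pd t (x t)"
    and adaptation: "adaptation_laws P pd x"
    and gyroscopic: "\<And>t. 0 \<le> t \<Longrightarrow> Gam0 P (x t) = 0"
    and xi_nonzero: "\<And>t. 0 \<le> t \<Longrightarrow> xi P pd t (x t) \<noteq> 0"
  shows
    "(measure_zero_states (antipodal_states P pd) \<and>
     (x 0 \<notin> antipodal_states P pd \<longrightarrow>
        ((\<lambda>t. z1 P pd t (x t)) \<longlongrightarrow> 0) at_top \<and>
        ((\<lambda>t. z2 P pd t (x t)) \<longlongrightarrow> 0) at_top \<and>
        (xi_uniformly_nonzero P pd x \<longrightarrow>
           ((\<lambda>t. z_r P pd t (x t)) \<longlongrightarrow> 0) at_top \<and>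
           ((\<lambda>t. z_Om P pd t (x t)) \<longlongrightarrow> 0) at_top)))
     \<and>
     (bounded_signal (\<lambda>t. z1 P pd t (x t)) \<and>
     bounded_signal (\<lambda>t. z2 P pd t (x t)) \<and>
     bounded_signal (\<lambda>t. err P pd t (x t)) \<and>
     bounded_signal (\<lambda>t. z_r P pd t (x t)) \<and>
     bounded_signal (\<lambda>t. z_Om P pd t (x t)) \<and>
     bounded_signal (\<lambda>t. bh1 (x t)) \<and>
     bounded_signal (\<lambda>t. bh2 (x t)) \<and>
     bounded_signal (\<lambda>t. bh3 (x t)) \<and>
     bounded_signal (\<lambda>t. v_del P (x t)) \<and>
     bounded_signal (\<lambda>t. xi P pd t (x t)) \<and>
     bounded_signal (\<lambda>t. u3_bar P pd t (x t)) \<and>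
     (xi_uniformly_nonzero P pd x \<longrightarrow>
        bounded_signal (\<lambda>t. Om12 (x t)) \<and>
        bounded_signal (\<lambda>t. Om12c P pd t (x t)) \<and>
        bounded_signal (\<lambda>t. Gam_c P pd t (x t)) \<and>
        bounded_signal u))
     \<and>
     ((\<lambda>t. bh1 (x t)) \<longlongrightarrow> b) at_top"
proof -
  interpret tracking_loop P b pd u x
    by unfold_locales (fact assms)+
  show ?thesis
    using measure_zero_antipodal tracking_convergence attitude_convergence basic_bounds
      translational_bounds attitude_bounds Gam_c_bounded input_bounded estimate_convergence
    by blast
qed

end
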